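(* For every $c\in\mathbb{N}$ there exists $\kappa\in\mathbb{N}$ such that the following holds. Let $n,\ell,d\in\mathbb{N}$ with $1\le \ell\le n$. Let $\pi:\mathbb{R}^n\to\mathbb{R}^\ell$ be the projection onto the last $\ell$ coordinates and let $S\subset\mathbb{R}^n$ be a bounded closed semialgebraic set with $D(S)=(n,c,d)$. Then, for every $\epsilon>0$ there exists a closed semialgebraic set $A_\epsilon\subset\mathbb{R}^n$ such that: (i) $\dim(A_\epsilon)\le \ell$; (ii) $A_\epsilon\subseteq\mathcal{U}_\epsilon(S)$; (iii) $\mathrm{dist}_H(\pi(A_\epsilon),\pi(S))\le\epsilon$; (iv) $D(A_\epsilon)=(n,\kappa,\kappa d)$.
   Context: Diagram: for a semialgebraic set $S\subset\mathbb{R}^n$, a representation of $S$ is a description $$S=\bigcup_{i=1}^a\bigcap_{j=1}^{b_i}\{x\in\mathbb{R}^n\mid \mathrm{sign}(p_{ij}(x))=\sigma_{ij}\}$$ with real polynomials $p_{ij}$ in $n$ variables and $\sigma_{ij}\in\{0,+1,-1\}$. The notation "$D(S)=(m,c,d)$" means that there exists a representation of $S$ of this form with $n\le m$, $a\cdot\max_i b_i\le c$ and $\max_{i,j}\deg(p_{ij})\le d$ (so it is a set of upper bounds, not an equality of invariants). $\mathcal{U}_\epsilon(S)$ is the closed Euclidean $\epsilon$-neighbourhood of $S$, i.e. the set of points at Euclidean distance $\le\epsilon$ from $S$. $\mathrm{dist}_H$ is the Hausdorff distance between subsets of Euclidean space. $\dim$ is the dimension of a semialgebraic set (the maximal $m$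 such that the set contains a subset semialgebraically homeomorphic to the open cube $(0,1)^m$). *)

theory Defs
  imports "HOL-Analysis.Analysis" "HOL-Library.Poly_Mapping"
begin

text \<open>The dimension is a variable of type \<^typ>\<open>nat\<close>, so points of the \<open>n\<close>-dimensional space
  are functions on \<^typ>\<open>nat\<close> that vanish from index \<open>n\<close> on, as in \<^const>\<open>Euclidean_space\<close>.\<close>

abbreviation Rn :: "nat \<Rightarrow> (nat \<Rightarrow> real) set" where
  "Rn n \<equiv> topspace (Euclidean_space n)"

definition eucl_dist :: "nat \<Rightarrow> (nat \<Rightarrow> real) \<Rightarrow> (nat \<Rightarrow> real) \<Rightarrow> real" where
  "eucl_dist n x y = L2_set (\<lambda>i. x i - y i) {..<n}"

lemma Metric_space_eucl_dist: "Metric_space (Rn n) (eucl_dist n)"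
proof
  fix x y z :: "nat \<Rightarrow> real"
  show "0 \<le> eucl_dist n x y"
    by (simp add: eucl_dist_def L2_set_nonneg)
  show "eucl_dist n x y = eucl_dist n y x"
    by (simp add: eucl_dist_def L2_set_def power2_commute)
  show "eucl_dist n x y = 0 \<longleftrightarrow> x = y" if "x \<in> Rn n" "y \<in> Rn n"
  proof
    assume "eucl_dist n x y = 0"
    then have "x i = y i" if "i < n" for i
      using that by (simp add: eucl_dist_def L2_set_eq_0_iff)
    then show "x = y"
      using that by (intro ext) (metis (mono_tags, lifting) linorder_not_less mem_Collect_eq
          topspace_Euclidean_space)
  qed (simp add: eucl_dist_def L2_set_def)
  have "(\<lambda>i. x i - z i) = (\<lambda>i. (x i - y i) + (y i - z i))"
    by simp
  then show "eucl_dist n x z \<le> eucl_dist n x y + eucl_dist n y z"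
    unfolding eucl_dist_def by (metis L2_set_triangle_ineq)
qed

definition bounded_in :: "nat \<Rightarrow> (nat \<Rightarrow> real) set \<Rightarrow> bool" where
  "bounded_in n S \<longleftrightarrow> Metric_space.mbounded (Rn n) (eucl_dist n) S"

text \<open>Distances to sets are extended nonnegative reals, so that the distance to the empty set is
  \<open>\<infinity>\<close>. Hence the neighbourhood of the empty set is empty, and the Hausdorff distance between the
  empty set and a nonempty set is \<open>\<infinity>\<close>.\<close>

definition dist_to_set :: "nat \<Rightarrow> (nat \<Rightarrow> real) \<Rightarrow> (nat \<Rightarrow> real) set \<Rightarrow> ennreal" where
  "dist_to_set n x S = (INF y\<in>S. ennreal (eucl_dist n x y))"

definition nbhd :: "nat \<Rightarrow> real \<Rightarrow> (nat \<Rightarrow> real) set \<Rightarrow> (nat \<Rightarrow> real) set" where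
  "nbhd n \<epsilon> S = {x \<in> Rn n. dist_to_set n x S \<le> ennreal \<epsilon>}"

definition hausdorff_dist :: "nat \<Rightarrow> (nat \<Rightarrow> real) set \<Rightarrow> (nat \<Rightarrow> real) set \<Rightarrow> ennreal" where
  "hausdorff_dist n A B = max (SUP x\<in>A. dist_to_set n x B) (SUP y\<in>B. dist_to_set n y A)"

definition proj_last :: "nat \<Rightarrow> nat \<Rightarrow> (nat \<Rightarrow> real) \<Rightarrow> (nat \<Rightarrow> real)" where
  "proj_last n l x = (\<lambda>i. if i < l then x (n - l + i) else 0)"

text \<open>A monomial is a finitely supported exponent function; a polynomial maps each monomial
  to its coefficient.\<close>

type_synonym rpoly = "(nat \<Rightarrow>\<^sub>0 nat) \<Rightarrow>\<^sub>0 real"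

definition poly_in_vars :: "nat \<Rightarrow> rpoly \<Rightarrow> bool" where
  "poly_in_vars n p \<longleftrightarrow> (\<forall>m \<in> Poly_Mapping.keys p. Poly_Mapping.keys m \<subseteq> {..<n})"

definition poly_eval :: "rpoly \<Rightarrow> (nat \<Rightarrow> real) \<Rightarrow> real" where
  "poly_eval p x = (\<Sum>m\<in>Poly_Mapping.keys p. Poly_Mapping.lookup p m *
     (\<Prod>i\<in>Poly_Mapping.keys m. x i ^ Poly_Mapping.lookup m i))"

definition monom_degree :: "(nat \<Rightarrow>\<^sub>0 nat) \<Rightarrow> nat" where
  "monom_degree m = (\<Sum>i\<in>Poly_Mapping.keys m. Poly_Mapping.lookup m i)"

text \<open>The total degree; the zero polynomial has degree \<open>0\<close>.\<close>

definition poly_degree :: "rpoly \<Rightarrow> nat" where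
  "poly_degree p = Max (insert 0 (monom_degree ` Poly_Mapping.keys p))"

text \<open>The factor \<open>Rn n\<close> matters only if \<open>b i = 0\<close>: the empty intersection is the whole space.\<close>

definition sa_representation ::
  "nat \<Rightarrow> (nat \<Rightarrow> real) set \<Rightarrow> nat \<Rightarrow> (nat \<Rightarrow> nat) \<Rightarrow> (nat \<Rightarrow> nat \<Rightarrow> rpoly) \<Rightarrow> (nat \<Rightarrow> nat \<Rightarrow> real) \<Rightarrow> bool"
where
  "sa_representation n S a b p \<sigma> \<longleftrightarrow>
     (\<forall>i<a. \<forall>j<b i. poly_in_vars n (p i j) \<and> \<sigma> i j \<in> {0, 1, -1}) \<and>
     S = (\<Union>i<a. Rn n \<inter> (\<Inter>j<b i. {x \<in> Rn n. sgn (poly_eval (p i j) x) = \<sigma> i j}))"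

definition semialgebraic :: "nat \<Rightarrow> (nat \<Rightarrow> real) set \<Rightarrow> bool" where
  "semialgebraic n S \<longleftrightarrow> (\<exists>a b p \<sigma>. sa_representation n S a b p \<sigma>)"

text \<open>\<open>diagram n S m c d\<close> renders \<open>D(S) = (m, c, d)\<close> for a subset \<open>S\<close> of the \<open>n\<close>-dimensional space;
  the three numbers are upper bounds. The maximum of the \<open>b i\<close> over an empty index set is \<open>0\<close>.\<close>

definition diagram :: "nat \<Rightarrow> (nat \<Rightarrow> real) set \<Rightarrow> nat \<Rightarrow> nat \<Rightarrow> nat \<Rightarrow> bool" where
  "diagram n S m c d \<longleftrightarrow> n \<le> m \<and>
     (\<exists>a b p \<sigma>. sa_representation n S a b p \<sigma> \<and>
        a * Max (insert 0 (b ` {..<a})) \<le> c \<and>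
        (\<forall>i<a. \<forall>j<b i. poly_degree (p i j) \<le> d))"

definition open_cube :: "nat \<Rightarrow> (nat \<Rightarrow> real) set" where
  "open_cube m = {x \<in> Rn m. \<forall>i<m. 0 < x i \<and> x i < 1}"

definition pair_vec :: "nat \<Rightarrow> (nat \<Rightarrow> real) \<Rightarrow> (nat \<Rightarrow> real) \<Rightarrow> (nat \<Rightarrow> real)" where
  "pair_vec m x y = (\<lambda>i. if i < m then x i else y (i - m))"

definition sa_homeomorphism ::
  "nat \<Rightarrow> (nat \<Rightarrow> real) set \<Rightarrow> nat \<Rightarrow> (nat \<Rightarrow> real) set \<Rightarrow> ((nat \<Rightarrow> real) \<Rightarrow> (nat \<Rightarrow> real)) \<Rightarrow> bool"
where
  "sa_homeomorphism m S n T f \<longleftrightarrow>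
     semialgebraic m S \<and> semialgebraic n T \<and>
     homeomorphic_map (subtopology (Euclidean_space m) S) (subtopology (Euclidean_space n) T) f \<and>
     semialgebraic (m + n) ((\<lambda>x. pair_vec m x (f x)) ` S)"

text \<open>The supremum is taken in \<^typ>\<open>ereal\<close>, so that the empty set has dimension \<open>-\<infinity>\<close>;
  \<open>open_cube 0\<close> is a single point, so nonempty semialgebraic sets have dimension at least \<open>0\<close>.\<close>

definition sa_dim :: "nat \<Rightarrow> (nat \<Rightarrow> real) set \<Rightarrow> ereal" where
  "sa_dim n S = (SUP m \<in> {m. \<exists>T\<subseteq>S. \<exists>f. sa_homeomorphism m (open_cube m) n T f}. ereal (real m))"

end

theory Submission
  imports Defs
begin

text \<open>Each basic piece \<open>C\<close> of \<open>S\<close> is relaxed: equations \<open>p = 0\<close> become \<open>\<eta> - p\<^sup>2 > 0\<close>, strict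
  inequalities \<open>\<sigma> p > 0\<close> become \<open>\<sigma> p - \<delta> > 0\<close>, and a ball \<open>R - |x|\<^sup>2 > 0\<close> is added. With
  \<open>\<delta>\<close> chosen for a finite \<open>\<epsilon>\<close>-net of \<open>C\<close> and then \<open>\<eta>\<close> small, compactness keeps the relaxed set in the
  \<open>\<epsilon>\<close>-neighbourhood of \<open>C\<close>. Let \<open>G\<close> be the product of the relaxed functions, \<open>k = n - l\<close>, and let \<open>e\<close> be
  even and larger than the degree of \<open>G\<close>. The maximum of \<open>G - t (x\<^sub>0 ^ e + \<dots> + x\<^sub>k\<^sub>-\<^sub>1 ^ e)\<close> on a fibre of the projection
  through a point of the net is a critical point in the fibre direction; \<open>A\<close> is the set of such critical points
  with \<open>G \<ge> \<tau>\<close>. The critical equations read \<open>x\<^sub>i ^ (e - 1) = q\<^sub>i\<close> with \<open>q\<^sub>i\<close> of lower degree, so reduction to monomials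
  with all exponents below \<open>e - 1\<close> shows that the fibres of \<open>A\<close> over the last \<open>l\<close> coordinates are finite.

  A set with finite fibres over the \<open>l\<close>-dimensional space contains no cube of dimension \<open>l + 1\<close>: this is Lebesgue's
  covering theorem, which follows from the Poincare-Miranda theorem by means of \<open>l + 1\<close> shifted grids.\<close>

section \<open>Sets with finite fibres\<close>

lemma tendsto_fun_iff:
  fixes f :: "'b \<Rightarrow> 'a \<Rightarrow> 'c::topological_space"
  shows "(f \<longlongrightarrow> l) F \<longleftrightarrow> (\<forall>i. ((\<lambda>x. f x i) \<longlongrightarrow> l i) F)"
proof -
  have "(f \<longlongrightarrow> l) F \<longleftrightarrow> limitin (product_topology (\<lambda>i. euclidean) UNIV) f l F"
    by (simp add: euclidean_product_topology limitin_canonical_iff)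
  then show ?thesis
    by (simp add: limitin_componentwise limitin_canonical_iff)
qed

lemma compact_box_fun:
  fixes a b :: "'a \<Rightarrow> real"
  shows "compact {x. \<forall>i. a i \<le> x i \<and> x i \<le> b i}"
proof -
  have "compactin (product_topology (\<lambda>i. euclidean) UNIV) (PiE UNIV (\<lambda>i. {a i..b i}))"
    by (simp add: compactin_PiE)
  moreover have "PiE UNIV (\<lambda>i. {a i..b i}) = {x. \<forall>i. a i \<le> x i \<and> x i \<le> b i}"
    by auto
  ultimately show ?thesis
    by (simp add: euclidean_product_topology)
qed

section \<open>The Poincare-Miranda theorem\<close>

definition closed_cube :: "nat \<Rightarrow> (nat \<Rightarrow> real) set" where
  "closed_cube n = {x \<in> Rn n. \<forall>i<n. 0 \<le> x i \<and> x i \<le> 1}"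

lemma compact_closed_cube: "compact (closed_cube n)"
proof -
  have "closed_cube n = {x. \<forall>i. 0 \<le> x i \<and> x i \<le> (if i < n then 1 else 0)}"
    by (force simp: closed_cube_def topspace_Euclidean_space intro: order_antisym)
  then show ?thesis
    using compact_box_fun[of "\<lambda>i. 0" "\<lambda>i. if i < n then 1 else 0"] by simp
qed

text \<open>Kuhn's combinatorial lemma is applied to finer and finer grids, the label of a vertex in
  direction \<open>i\<close> recording the sign of \<open>\<phi> i\<close>. Each grid has a small
  cube on which every label takes both values, and a limit of such cubes is a common zero.\<close>

theorem poincare_miranda:
  assumes cont: "\<And>i. i < n \<Longrightarrow> continuous_on (closed_cube n) (\<phi> i)"
    and lo: "\<And>i x. i < n \<Longrightarrow> x \<in> closed_cube n \<Longrightarrow> x i = 0 \<Longrightarrow> \<phi> i x \<le> (0::real)"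
    and hi: "\<And>i x. i < n \<Longrightarrow> x \<in> closed_cube n \<Longrightarrow> x i = 1 \<Longrightarrow> 0 \<le> \<phi> i x"
  obtains x where "x \<in> closed_cube n" "\<And>i. i < n \<Longrightarrow> \<phi> i x = 0"
proof -
  \<comment> \<open>Clamping by \<open>min 1\<close> puts \<open>pt p q\<close> into the cube for
    every \<open>q\<close>, so no range conditions on vertices have to be carried along.\<close>
  define pt :: "nat \<Rightarrow> (nat \<Rightarrow> nat) \<Rightarrow> nat \<Rightarrow> real" where
    "pt p q = (\<lambda>i. if i < n then min 1 (real (q i) / real (Suc p)) else 0)" for p q
  have pt: "pt p q \<in> closed_cube n" for p q
    by (auto simp: pt_def closed_cube_def topspace_Euclidean_space)
  \<comment> \<open>The first two cases enforce the boundary labels of Kuhn's lemma, even where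
    \<open>\<phi> i\<close> vanishes on the upper face; \<open>lo\<close> and \<open>hi\<close> keep
    \<open>l0\<close> and \<open>l1\<close> true there.\<close>
  define label :: "nat \<Rightarrow> (nat \<Rightarrow> nat) \<Rightarrow> nat \<Rightarrow> nat" where
    "label p q i = (if q i = 0 then 0 else if q i = Suc p then 1
        else if \<phi> i (pt p q) \<le> 0 then 0 else 1)" for p q i
  have l0: "\<phi> i (pt p q) \<le> 0" if "label p q i = 0" "i < n" for p q i
    using that lo[OF that(2) pt] by (auto simp: label_def pt_def split: if_splits)
  have l1: "0 \<le> \<phi> i (pt p q)" if "label p q i \<noteq> 0" "i < n" for p q i
    using that hi[OF that(2) pt] by (auto simp: label_def pt_def split: if_splits)
  define near where "near q r \<longleftrightarrow> (\<forall>j<n. q j \<le> r j \<and> r j \<le> q j + 1)" for q r :: "nat \<Rightarrow> nat"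
  have "\<exists>q. \<forall>i<n. \<exists>r s. near q r \<and> near q s \<and> label p r i \<noteq> label p s i" for p
  proof -
    have lab: "\<forall>x. (\<forall>i<n. x i \<le> Suc p) \<longrightarrow> (\<forall>i<n. label p x i = 0 \<or> label p x i = 1)"
      "\<forall>x. (\<forall>i<n. x i \<le> Suc p) \<longrightarrow> (\<forall>i<n. x i = 0 \<longrightarrow> label p x i = 0)"
      "\<forall>x. (\<forall>i<n. x i \<le> Suc p) \<longrightarrow> (\<forall>i<n. x i = Suc p \<longrightarrow> label p x i = 1)"
      by (auto simp: label_def)
    show ?thesis
      by (rule kuhn_lemma[OF zero_less_Suc lab]) (auto simp only: near_def)
  qed
  then obtain q where q: "\<And>p. \<forall>i<n. \<exists>r s. near (q p) r \<and> near (q p) s \<and> label p r i \<noteq> label p s i"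
    by metis
  define w where "w p i = (SOME w. near (q p) (fst w) \<and> near (q p) (snd w) \<and> label p (fst w) i \<noteq> label p (snd w) i)" for p i
  define r s where "r p i = fst (w p i)" and "s p i = snd (w p i)" for p i
  have "near (q p) (r p i) \<and> near (q p) (s p i) \<and> label p (r p i) i \<noteq> label p (s p i) i" if i: "i < n" for p i
  proof -
    obtain u v where "near (q p) u" "near (q p) v" "label p u i \<noteq> label p v i"
      using q[of p] i by blast
    then have "\<exists>w. near (q p) (fst w) \<and> near (q p) (snd w) \<and> label p (fst w) i \<noteq> label p (snd w) i"
      by (intro exI[of _ "(u, v)"]) simp
    from someI_ex[OF this] show ?thesis
      by (simp add: r_def s_def w_def)
  qed
  then have rs: "\<And>p i. i < n \<Longrightarrow> near (q p) (r p i)" "\<And>p i. i < n \<Longrightarrow> near (q p) (s p i)"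
    "\<And>p i. i < n \<Longrightarrow> label p (r p i) i \<noteq> label p (s p i) i"
    by auto
  obtain x \<sigma> where x: "x \<in> closed_cube n" and \<sigma>: "strict_mono \<sigma>"
    and lim: "(\<lambda>k. pt (\<sigma> k) (q (\<sigma> k))) \<longlonglongrightarrow> x"
    using seq_compactE[OF compact_imp_seq_compact[OF compact_closed_cube], of "\<lambda>p. pt p (q p)" n] pt
    by (auto simp: o_def)
  \<comment> \<open>Vertices of the \<open>p\<close>-th small cube differ from its corner by at most
    \<open>1 / Suc p\<close> in each coordinate, so every choice of them has the same limit along
    \<open>\<sigma>\<close>.\<close>
  have lim_near: "(\<lambda>k. pt (\<sigma> k) (u (\<sigma> k))) \<longlonglongrightarrow> x"
    if u: "\<And>p. near (q p) (u p)" for u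
    unfolding tendsto_fun_iff
  proof
    fix j
    have "\<bar>pt p (u p) j - pt p (q p) j\<bar> \<le> 1 / real (Suc p)" for p
    proof (cases "j < n")
      case True
      then have "q p j \<le> u p j" "u p j \<le> Suc (q p j)"
        using u[of p] by (simp_all add: near_def)
      then have "real (q p j) / real (Suc p) \<le> real (u p j) / real (Suc p)"
         "real (u p j) / real (Suc p) \<le> real (q p j) / real (Suc p) + 1 / real (Suc p)"
        unfolding add_divide_distrib[symmetric] by (intro divide_right_mono; simp)+
      then show ?thesis
        using True by (auto simp: pt_def)
    qed (simp add: pt_def)
    then have "(\<lambda>p. pt p (u p) j - pt p (q p) j) \<longlonglongrightarrow> 0"
      by (intro tendsto_rabs_zero_cancel[OF tendsto_sandwich[OF _ _ tendsto_const LIMSEQ_inverse_real_of_nat]])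
        (auto simp: inverse_eq_divide)
    from LIMSEQ_subseq_LIMSEQ[OF this \<sigma>]
    have "(\<lambda>k. pt (\<sigma> k) (u (\<sigma> k)) j - pt (\<sigma> k) (q (\<sigma> k)) j) \<longlonglongrightarrow> 0"
      by (simp add: o_def)
    from tendsto_add[OF this lim[unfolded tendsto_fun_iff, rule_format, of j]]
    show "(\<lambda>k. pt (\<sigma> k) (u (\<sigma> k)) j) \<longlonglongrightarrow> x j"
      by simp
  qed
  have "\<phi> i x = 0" if i: "i < n" for i
  proof -
    have cl: "(\<lambda>k. \<phi> i (pt (\<sigma> k) (u (\<sigma> k)))) \<longlonglongrightarrow> \<phi> i x"
      if "\<And>p. near (q p) (u p)" for u
      using cont[OF i, unfolded continuous_on_sequentially] lim_near[OF that] x pt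
      by (auto simp: o_def)
    \<comment> \<open>At vertices with different labels \<open>\<phi> i\<close> has opposite weak
      signs, so the product is at most 0; in the limit it becomes a square.\<close>
    have "(\<lambda>k. \<phi> i (pt (\<sigma> k) (r (\<sigma> k) i)) * \<phi> i (pt (\<sigma> k) (s (\<sigma> k) i))) \<longlonglongrightarrow> \<phi> i x * \<phi> i x"
      using rs(1,2)[OF i] by (intro tendsto_mult cl) auto
    moreover have "\<phi> i (pt p (r p i)) * \<phi> i (pt p (s p i)) \<le> 0" for p
    proof (cases "label p (r p i) i = 0")
      case True
      then have "label p (s p i) i \<noteq> 0"
        using rs(3)[OF i, of p] by simp
      then show ?thesis
        using l0[OF True i] l1[OF _ i] by (intro mult_nonpos_nonneg)
    next
      case False
      then have "label p (s p i) i = 0"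
        using rs(3)[OF i, of p] unfolding label_def by (simp split: if_splits)
      then show ?thesis
        using l1[OF False i] l0[OF _ i] by (intro mult_nonneg_nonpos)
    qed
    ultimately have "\<phi> i x * \<phi> i x \<le> 0"
      by (intro tendsto_upperbound[where F=sequentially]) auto
    then show ?thesis
      by (metis mult_le_0_iff order_antisym)
  qed
  with x show ?thesis
    using that by blast
qed

section \<open>Fibres of maps from a cube to a space of smaller dimension\<close>

text \<open>Compactness passes from exact fibres to \<open>\<delta>\<close>-near fibres. If every
  \<open>\<delta>\<close> failed, bad points would accumulate at some \<open>x\<close>; the level
  \<open>s\<close> avoided by the fibre of this limit would be met by points \<open>Y\<close>, whose
  own limit lies in that fibre and on that level.\<close>

lemma uniform_avoided_level:
  fixes g :: "(nat \<Rightarrow> real) \<Rightarrow> nat \<Rightarrow> real"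
  assumes cont: "\<And>i. i < l \<Longrightarrow> continuous_on K (\<lambda>x. g x i)" and "compact K"
    and avoid: "\<And>x. x \<in> K \<Longrightarrow> \<exists>s. 0 < s \<and> s < 1 \<and> (\<forall>x'\<in>K. x' j = s \<longrightarrow> (\<exists>i<l. g x' i \<noteq> g x i))"
  shows "\<exists>\<delta>>0. \<forall>x\<in>K. \<exists>s. 0 < s \<and> s < 1 \<and> (\<forall>x'\<in>K. x' j = s \<longrightarrow> (\<exists>i<l. \<delta> \<le> \<bar>g x' i - g x i\<bar>))"
proof (rule ccontr)
  assume not: "\<not> ?thesis"
  define far where "far \<delta> x s \<longleftrightarrow> (\<forall>x'\<in>K. x' j = s \<longrightarrow> (\<exists>i<l. \<delta> \<le> \<bar>g x' i - g x i\<bar>))" for \<delta> x s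
  have no: "\<exists>x\<in>K. \<forall>s. 0 < s \<and> s < 1 \<longrightarrow> \<not> far \<delta> x s" if "\<delta> > 0" for \<delta>
    using not that unfolding far_def[symmetric] by blast
  have "\<exists>x\<in>K. \<forall>s. 0 < s \<and> s < 1 \<longrightarrow> (\<exists>x'\<in>K. x' j = s \<and> (\<forall>i<l. \<bar>g x' i - g x i\<bar> < inverse (real (Suc k))))" for k
    using no[of "inverse (real (Suc k))"] unfolding far_def by (simp add: not_le)
  then obtain X where X: "\<And>k. X k \<in> K"
    "\<And>k s. 0 < s \<Longrightarrow> s < 1 \<Longrightarrow> \<exists>x'\<in>K. x' j = s \<and> (\<forall>i<l. \<bar>g x' i - g (X k) i\<bar> < inverse (real (Suc k)))"
    by metis
  obtain x \<sigma> where x: "x \<in> K" and \<sigma>: "strict_mono \<sigma>" and lim: "(X \<circ> \<sigma>) \<longlonglongrightarrow> x"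
    using seq_compactE[OF compact_imp_seq_compact[OF \<open>compact K\<close>], of X] X(1) by blast
  obtain s where s: "0 < s" "s < 1" and sx: "\<And>x'. x' \<in> K \<Longrightarrow> x' j = s \<Longrightarrow> \<exists>i<l. g x' i \<noteq> g x i"
    using avoid[OF x] by blast
  obtain Y where Y: "\<And>k. Y k \<in> K" "\<And>k. Y k j = s"
    "\<And>k i. i < l \<Longrightarrow> \<bar>g (Y k) i - g (X k) i\<bar> < inverse (real (Suc k))"
    using X(2)[OF s] by metis
  obtain y \<tau> where y: "y \<in> K" and \<tau>: "strict_mono \<tau>" and lim': "((Y \<circ> \<sigma>) \<circ> \<tau>) \<longlonglongrightarrow> y"
    using seq_compactE[OF compact_imp_seq_compact[OF \<open>compact K\<close>], of "Y \<circ> \<sigma>"] Y(1) by auto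
  have "(\<lambda>k. (((Y \<circ> \<sigma>) \<circ> \<tau>) k) j) \<longlonglongrightarrow> y j"
    using lim' unfolding tendsto_fun_iff by blast
  then have "y j = s"
    by (simp add: o_def Y(2) LIMSEQ_const_iff)
  moreover have "g y i = g x i" if "i < l" for i
  proof -
    have "(\<lambda>k. g (((Y \<circ> \<sigma>) \<circ> \<tau>) k) i) \<longlonglongrightarrow> g y i"
      using cont[OF that, unfolded continuous_on_sequentially] lim' y Y(1) by (auto simp: o_def)
    moreover have "(\<lambda>k. g (((X \<circ> \<sigma>) \<circ> \<tau>) k) i) \<longlonglongrightarrow> g x i"
      using cont[OF that, unfolded continuous_on_sequentially] LIMSEQ_subseq_LIMSEQ[OF lim \<tau>] x X(1)
      by (auto simp: o_def)
    ultimately have "(\<lambda>k. g (Y (\<sigma> (\<tau> k))) i - g (X (\<sigma> (\<tau> k))) i) \<longlonglongrightarrow> g y i - g x i"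
      by (auto simp: o_def intro: tendsto_diff)
    moreover have "(\<lambda>k. g (Y k) i - g (X k) i) \<longlonglongrightarrow> 0"
      by (rule tendsto_rabs_zero_cancel[OF tendsto_sandwich[OF _ _ tendsto_const LIMSEQ_inverse_real_of_nat]])
        (use Y(3)[OF that] in \<open>auto intro!: always_eventually less_imp_le simp del: of_nat_Suc\<close>)
    from LIMSEQ_subseq_LIMSEQ[OF LIMSEQ_subseq_LIMSEQ[OF this \<sigma>] \<tau>]
    have "(\<lambda>k. g (Y (\<sigma> (\<tau> k))) i - g (X (\<sigma> (\<tau> k))) i) \<longlonglongrightarrow> 0"
      by (simp add: o_def)
    ultimately show ?thesis
      using LIMSEQ_unique by fastforce
  qed
  ultimately show False
    using sx[OF y] by blast
qed

text \<open>A product of tent functions. For \<open>\<delta> > 0\<close> it is supported on the cell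
  \<open>a\<close> of the grid of mesh \<open>\<delta>\<close> that is shifted by
  \<open>\<delta> * t\<close> in every coordinate.\<close>

definition cube_bump :: "nat \<Rightarrow> real \<Rightarrow> real \<Rightarrow> (nat \<Rightarrow> int) \<Rightarrow> (nat \<Rightarrow> real) \<Rightarrow> real" where
  "cube_bump l \<delta> t a y = (\<Prod>i<l. max 0 (1 / 2 - \<bar>y i / \<delta> - t - of_int (a i) - 1 / 2\<bar>))"

lemma cube_bump_nonneg: "0 \<le> cube_bump l \<delta> t a y"
  unfolding cube_bump_def by (intro prod_nonneg) auto

lemma cube_bump_nonzero_iff:
  "cube_bump l \<delta> t a y \<noteq> 0 \<longleftrightarrow> (\<forall>i<l. of_int (a i) < y i / \<delta> - t \<and> y i / \<delta> - t < of_int (a i) + 1)"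
proof -
  have "max 0 (1 / 2 - \<bar>u - v - 1 / 2\<bar>) \<noteq> 0 \<longleftrightarrow> v < u \<and> u < v + 1" for u v :: real
    by (auto simp: abs_if max_def)
  then show ?thesis
    unfolding cube_bump_def by auto
qed

text \<open>Pigeonhole: any two of the \<open>l + 1\<close> shifts differ by a non-integer, so one
  coordinate lies on a wall of at most one shifted grid, and \<open>l\<close> coordinates cannot
  spoil all grids.\<close>

lemma shifted_grids_avoid:
  fixes z :: "nat \<Rightarrow> real"
  obtains j where "j \<le> l" "\<And>i. i < l \<Longrightarrow> z i - real j / real (Suc l) \<notin> \<int>"
proof (rule ccontr)
  assume "\<not> thesis"
  then have "\<forall>j\<le>l. \<exists>i<l. z i - real j / real (Suc l) \<in> \<int>"
    using that by blast
  then obtain h where h: "\<And>j. j \<le> l \<Longrightarrow> h j < l \<and> z (h j) - real j / real (Suc l) \<in> \<int>"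
    by metis
  have "\<not> inj_on h {..l}"
  proof
    assume "inj_on h {..l}"
    then have "card {..l} \<le> card {..<l}"
      by (rule card_inj_on_le) (use h in auto)
    then show False
      by simp
  qed
  then obtain j k where jk: "j \<le> l" "k \<le> l" "j < k" "h j = h k"
    unfolding inj_on_def by (metis atMost_iff linorder_neqE_nat)
  then have "(z (h j) - real j / real (Suc l)) - (z (h j) - real k / real (Suc l)) \<in> \<int>"
    using h[of j] h[of k] jk by (intro Ints_diff[of "_ - _" "_ - _"]) auto
  then have "real (k - j) / real (Suc l) \<in> \<int>"
    using jk by (simp add: of_nat_diff diff_divide_distrib)
  moreover have "0 < real (k - j) / real (Suc l)" "real (k - j) / real (Suc l) < 1"
    using jk by auto
  ultimately show False
    by (metis Ints_cases of_int_0_less_iff of_int_less_1_iff zless_imp_add1_zle add_0 not_less)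
qed

text \<open>The inverse images of the \<open>l + 1\<close> shifted grids cover the cube. If in each small grid cube of
  the \<open>j\<close>-th grid the level \<open>x j = s\<close> is avoided, then the functions \<open>x j - s\<close>, glued by bumps,
  violate the Poincare-Miranda theorem.\<close>

theorem fibre_crosses_levels:
  fixes g :: "(nat \<Rightarrow> real) \<Rightarrow> nat \<Rightarrow> real"
  assumes cont: "\<And>i. i < l \<Longrightarrow> continuous_on (closed_cube (Suc l)) (\<lambda>x. g x i)"
  shows "\<exists>j\<le>l. \<exists>x\<in>closed_cube (Suc l).
    \<forall>s. 0 < s \<and> s < 1 \<longrightarrow> (\<exists>x'\<in>closed_cube (Suc l). x' j = s \<and> (\<forall>i<l. g x' i = g x i))"
proof (rule ccontr)
  assume not: "\<not> ?thesis"
  define K where "K = closed_cube (Suc l)"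
  note K = compact_closed_cube[of "Suc l", folded K_def]
  define far where "far j \<delta> x s \<longleftrightarrow> 0 < s \<and> s < 1 \<and>
      (\<forall>x'\<in>K. x' j = s \<longrightarrow> (\<exists>i<l. \<delta> \<le> \<bar>g x' i - g x i\<bar>))" for j \<delta> x s
  have "\<exists>\<delta>>0. \<forall>x\<in>K. \<exists>s. far j \<delta> x s" if "j \<le> l" for j
  proof -
    have "\<exists>s. 0 < s \<and> s < 1 \<and> (\<forall>x'\<in>K. x' j = s \<longrightarrow> (\<exists>i<l. g x' i \<noteq> g x i))" if "x \<in> K" for x
      using \<open>j \<le> l\<close> that not unfolding K_def by blast
    from uniform_avoided_level[OF cont[folded K_def] K this] show ?thesis
      unfolding far_def by blast
  qed
  then obtain d where d: "\<And>j. j \<le> l \<Longrightarrow> d j > 0" "\<And>j x. j \<le> l \<Longrightarrow> x \<in> K \<Longrightarrow> \<exists>s. far j (d j) x s"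
    by metis
  define \<delta> where "\<delta> = Min (d ` {..l})"
  have \<delta>: "\<delta> > 0" "\<And>j. j \<le> l \<Longrightarrow> \<delta> \<le> d j"
    using d(1) by (auto simp: \<delta>_def)
  define w where "w j = cube_bump l \<delta> (real j / real (Suc l))" for j
  define free where "free j a s \<longleftrightarrow> 0 < s \<and> s < 1 \<and> (\<forall>x\<in>K. w j a (g x) \<noteq> 0 \<longrightarrow> x j \<noteq> s)" for j a s
  \<comment> \<open>Two points in the inverse image of one cell have values of \<open>g\<close> less
    than \<open>\<delta> \<le> d j\<close> apart in every coordinate. So a level that is
    \<open>d j\<close>-far from one of them is missed by the whole inverse image. For an empty
    inverse image any level will do.\<close>
  have "\<exists>s. free j a s" if j: "j \<le> l" for j a
  proof (cases "\<exists>x\<in>K. w j a (g x) \<noteq> 0")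
    case True
    then obtain x where x: "x \<in> K" "w j a (g x) \<noteq> 0"
      by blast
    obtain s where s: "0 < s" "s < 1" "\<And>x'. x' \<in> K \<Longrightarrow> x' j = s \<Longrightarrow> \<exists>i<l. d j \<le> \<bar>g x' i - g x i\<bar>"
      using d(2)[OF j x(1)] unfolding far_def by blast
    have "w j a (g x') = 0" if x': "x' \<in> K" "x' j = s" for x'
    proof (rule ccontr)
      assume nz: "w j a (g x') \<noteq> 0"
      obtain i where i: "i < l" "d j \<le> \<bar>g x' i - g x i\<bar>"
        using s(3)[OF x'] by blast
      have "\<bar>g x' i / \<delta> - g x i / \<delta>\<bar> < 1"
        using nz x(2) i(1) unfolding w_def cube_bump_nonzero_iff by (smt (verit))
      then have "\<bar>g x' i - g x i\<bar> < \<delta>"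
        using \<delta>(1) by (simp add: diff_divide_distrib[symmetric])
      then show False
        using i(2) \<delta>(2)[OF j] by linarith
    qed
    with s(1,2) show ?thesis
      unfolding free_def by blast
  qed (auto simp: free_def intro: exI[of _ "1/2"])
  then obtain s where "\<And>j a. j \<le> l \<Longrightarrow> free j a (s j a)"
    by metis
  then have s: "\<And>j a. j \<le> l \<Longrightarrow> 0 < s j a \<and> s j a < (1::real)"
    "\<And>j a x. j \<le> l \<Longrightarrow> x \<in> K \<Longrightarrow> w j a (g x) \<noteq> 0 \<Longrightarrow> x j \<noteq> s j a"
    unfolding free_def by blast+
  have "\<exists>B. \<forall>x\<in>K. \<bar>g x i\<bar> \<le> B" if "i < l" for i
    using compact_imp_bounded[OF compact_continuous_image[OF cont[OF that, folded K_def] K]]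
    by (auto simp: bounded_iff)
  then obtain B where B: "\<And>i x. i < l \<Longrightarrow> x \<in> K \<Longrightarrow> \<bar>g x i\<bar> \<le> B i"
    by metis
  \<comment> \<open>Finitely many cells suffice for the bounded image of \<open>g\<close>. The
    margin 2 covers the shift, which is at most 1, and the rounding.\<close>
  define I where "I = PiE {..<l} (\<lambda>i. {- \<lceil>B i / \<delta>\<rceil> - 2..\<lceil>B i / \<delta>\<rceil>})"
  have "finite I"
    unfolding I_def by (intro finite_PiE) auto
  define \<phi> where "\<phi> j x = (\<Sum>a\<in>I. w j a (g x) * (x j - s j a))" for j x
  \<comment> \<open>The boundary signs hold because the bumps are nonnegative and all levels
    \<open>s j a\<close> lie strictly between 0 and 1.\<close>
  obtain x where x: "x \<in> K" "\<And>j. j < Suc l \<Longrightarrow> \<phi> j x = 0"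
  proof (rule poincare_miranda[of "Suc l" \<phi>, folded K_def])
    show "continuous_on K (\<phi> j)" if "j < Suc l" for j
      unfolding \<phi>_def w_def cube_bump_def
      using cont[folded K_def] \<delta>(1)
      by (intro continuous_on_sum continuous_on_mult continuous_on_prod continuous_on_max continuous_intros
          continuous_on_subset[OF continuous_on_product_coordinates])  auto
    show "\<phi> j x \<le> 0" if "j < Suc l" "x j = 0" for j x
      unfolding \<phi>_def using s(1)[of j] that
      by (intro sum_nonpos mult_nonneg_nonpos) (auto simp: w_def cube_bump_nonneg less_imp_le)
    show "0 \<le> \<phi> j x" if "j < Suc l" "x j = 1" for j x
      unfolding \<phi>_def using s(1)[of j] that
      by (intro sum_nonneg mult_nonneg_nonneg) (auto simp: w_def cube_bump_nonneg less_imp_le)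
  qed blast
  \<comment> \<open>Some grid has \<open>g x\<close> in the interior of a cell \<open>b\<close>.
    Open cells of one grid are disjoint, so only this bump survives in \<open>\<phi> j x\<close>,
    which forces \<open>x j = s j b\<close>.\<close>
  obtain j where j: "j \<le> l" "\<And>i. i < l \<Longrightarrow> g x i / \<delta> - real j / real (Suc l) \<notin> \<int>"
    using shifted_grids_avoid[of l "\<lambda>i. g x i / \<delta>"] by blast
  define u where "u i = g x i / \<delta> - real j / real (Suc l)" for i
  define b where "b = restrict (\<lambda>i. \<lfloor>u i\<rfloor>) {..<l}"
  have w_iff: "w j a (g x) \<noteq> 0 \<longleftrightarrow> (\<forall>i<l. of_int (a i) < u i \<and> u i < of_int (a i) + 1)" for a
    by (simp only: w_def cube_bump_nonzero_iff u_def)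
  have "of_int \<lfloor>u i\<rfloor> < u i \<and> u i < of_int \<lfloor>u i\<rfloor> + 1" if "i < l" for i
  proof -
    have "of_int \<lfloor>u i\<rfloor> \<noteq> u i"
      using j(2)[OF that] unfolding u_def by (metis Ints_of_int)
    then show ?thesis
      by linarith
  qed
  then have nz: "w j b (g x) \<noteq> 0"
    unfolding w_iff by (simp add: b_def)
  have "b \<in> I"
    unfolding I_def
  proof (rule PiE_I)
    fix i assume "i \<in> {..<l}"
    then have i: "i < l" by simp
    have "\<bar>g x i / \<delta>\<bar> \<le> B i / \<delta>"
      using B[OF i x(1)] \<delta>(1) by (simp add: divide_right_mono)
    moreover have "0 \<le> real j / real (Suc l)" "real j / real (Suc l) \<le> 1"
      using j(1) by auto
    ultimately have "- (B i / \<delta>) - 1 \<le> u i" "u i \<le> B i / \<delta>"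
      unfolding u_def by linarith+
    then have "\<lfloor>u i\<rfloor> \<le> \<lceil>B i / \<delta>\<rceil>" "- \<lceil>B i / \<delta>\<rceil> - 2 \<le> \<lfloor>u i\<rfloor>"
      by linarith+
    then show "b i \<in> {- \<lceil>B i / \<delta>\<rceil> - 2..\<lceil>B i / \<delta>\<rceil>}"
      using i by (simp add: b_def)
  qed (simp add: b_def)
  have "w j a (g x) = 0" if a: "a \<in> I - {b}" for a
  proof (rule ccontr)
    assume w: "w j a (g x) \<noteq> 0"
    have "a i = b i" if "i < l" for i
    proof -
      have "of_int (a i) < u i" "u i < of_int (a i) + 1"
        using w that unfolding w_iff by blast+
      then have "\<lfloor>u i\<rfloor> = a i"
        by linarith
      with that show ?thesis
        by (simp add: b_def)
    qed
    then have "a = b"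
      using a \<open>b \<in> I\<close> unfolding I_def by (intro PiE_ext[of a "{..<l}" _ b]) auto
    then show False
      using a by blast
  qed
  then have "\<phi> j x = w j b (g x) * (x j - s j b)"
    unfolding \<phi>_def by (subst sum.remove[OF \<open>finite I\<close> \<open>b \<in> I\<close>]) simp
  then show False
    using x(2)[of j] nz s(2)[OF j(1) x(1) nz] j(1) by simp
qed

section \<open>The dimension bound from finite fibres\<close>

lemma Euclidean_space_eq: "Euclidean_space n = top_of_set {x. \<forall>i\<ge>n. x i = 0}"
  unfolding Euclidean_space_def euclidean_product_topology ..

text \<open>An open cube of dimension above \<open>l\<close> contains a closed cube of dimension
  \<open>l + 1\<close>. There the composite of \<open>f\<close> and the projection has a fibre
  meeting every level in (0,1) of one coordinate; injectivity of \<open>f\<close> would embed this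
  infinite set into a finite fibre.\<close>

lemma open_cube_homeomorphism_le:
  assumes f: "homeomorphic_map (subtopology (Euclidean_space m) (open_cube m)) (subtopology (Euclidean_space n) T) f"
    and fin: "\<And>y. finite {x \<in> T. \<forall>i<l. proj_last n l x i = y i}"
  shows "m \<le> l"
proof (rule ccontr)
  assume "\<not> m \<le> l"
  then have ml: "Suc l \<le> m"
    by simp
  have "open_cube m \<subseteq> {x. \<forall>i\<ge>m. x i = 0}"
    by (auto simp: open_cube_def topspace_Euclidean_space)
  then have sub: "subtopology (Euclidean_space m) (open_cube m) = top_of_set (open_cube m)"
    by (simp add: Euclidean_space_eq subtopology_subtopology Int_absorb1)
  have cf: "continuous_map (top_of_set (open_cube m)) (top_of_set ({x. \<forall>i\<ge>n. x i = 0} \<inter> T)) f"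
    and inj: "inj_on f (open_cube m)" and im: "f ` open_cube m \<subseteq> T"
    using f unfolding sub unfolding Euclidean_space_eq subtopology_subtopology homeomorphic_eq_everything_map
    by auto
  have cont: "continuous_on (open_cube m) f"
    using cf unfolding continuous_map_in_subtopology by simp
  \<comment> \<open>The first \<open>l + 1\<close> coordinates are shrunk into [1/4, 3/4] and the
    others put at 1/2, which keeps the closed cube inside the open one.\<close>
  define e :: "(nat \<Rightarrow> real) \<Rightarrow> nat \<Rightarrow> real" where
    "e x = (\<lambda>i. if i < Suc l then 1 / 4 + x i / 2 else if i < m then 1 / 2 else 0)" for x
  have e: "e x \<in> open_cube m" if x: "x \<in> closed_cube (Suc l)" for x
  proof -
    have "0 < 1 / 4 + x i / 2 \<and> 1 / 4 + x i / 2 < 1" if "i < Suc l" for i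
    proof -
      have "0 \<le> x i \<and> x i \<le> 1"
        using x that unfolding closed_cube_def by blast
      then show ?thesis
        by auto
    qed
    then show ?thesis
      using ml unfolding open_cube_def e_def topspace_Euclidean_space by (auto simp del: less_Suc_eq)
  qed
  have inj_e: "inj_on e (closed_cube (Suc l))"
  proof (rule inj_onI, rule ext)
    fix x y i assume "x \<in> closed_cube (Suc l)" "y \<in> closed_cube (Suc l)" "e x = e y"
    then have "e x i = e y i" "i \<ge> Suc l \<longrightarrow> x i = 0 \<and> y i = 0"
      by (simp_all add: closed_cube_def topspace_Euclidean_space)
    then show "x i = y i"
      by (cases "i < Suc l") (simp_all add: e_def)
  qed
  have cont_e: "continuous_on (closed_cube (Suc l)) e"
  proof (rule continuous_on_coordinatewise_then_product)
    fix i
    have "continuous_on (closed_cube (Suc l)) (\<lambda>x. 1 / 4 + x i / 2)"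
      by (intro continuous_intros continuous_on_subset[OF continuous_on_product_coordinates]) auto
    then show "continuous_on (closed_cube (Suc l)) (\<lambda>x. e x i)"
      unfolding e_def by (cases "i < Suc l") (simp_all del: less_Suc_eq)
  qed
  define g where "g x = proj_last n l (f (e x))" for x
  have "continuous_on (closed_cube (Suc l)) (\<lambda>x. g x i)" if "i < l" for i
  proof -
    have "continuous_on (closed_cube (Suc l)) (\<lambda>x. f (e x))"
      using e by (intro continuous_on_compose2[OF cont cont_e]) blast
    then have "continuous_on (closed_cube (Suc l)) (\<lambda>x. f (e x) (n - l + i))"
      by (rule continuous_on_product_then_coordinatewise)
    then show ?thesis
      using that by (simp add: g_def proj_last_def)
  qed
  from fibre_crosses_levels[of l g, OF this] obtain j x where "x \<in> closed_cube (Suc l)"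
    and cross: "\<forall>s. 0 < s \<and> s < 1 \<longrightarrow> (\<exists>x'\<in>closed_cube (Suc l). x' j = s \<and> (\<forall>i<l. g x' i = g x i))"
    by blast
  define F where "F = {x' \<in> closed_cube (Suc l). \<forall>i<l. g x' i = g x i}"
  have "F \<subseteq> closed_cube (Suc l)" "e ` F \<subseteq> open_cube m"
    using e by (auto simp: F_def)
  then have "inj_on (f \<circ> e) F"
    by (metis comp_inj_on inj_on_subset inj_e inj)
  moreover have "(f \<circ> e) ` F \<subseteq> {z \<in> T. \<forall>i<l. proj_last n l z i = g x i}"
    using im e by (auto simp: F_def g_def)
  ultimately have "finite F"
    using fin finite_imageD finite_subset by blast
  moreover have "{0<..<1} \<subseteq> (\<lambda>x'. x' j) ` F"
  proof
    fix s :: real assume "s \<in> {0<..<1}"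
    then obtain x' where "x' \<in> closed_cube (Suc l)" "x' j = s" "\<forall>i<l. g x' i = g x i"
      using cross by auto
    then show "s \<in> (\<lambda>x'. x' j) ` F"
      unfolding F_def by (intro image_eqI[of _ _ x']) auto
  qed
  ultimately have "finite {0<..<1::real}"
    using finite_surj by blast
  then show False
    using infinite_Ioo[of 0 "1::real"] by simp
qed

corollary sa_dim_le_of_finite_fibres:
  assumes "\<And>y. finite {x \<in> A. \<forall>i<l. proj_last n l x i = y i}"
  shows "sa_dim n A \<le> ereal (real l)"
  unfolding sa_dim_def
proof (rule SUP_least)
  fix m assume "m \<in> {m. \<exists>T\<subseteq>A. \<exists>f. sa_homeomorphism m (open_cube m) n T f}"
  then obtain T f where "T \<subseteq> A" "sa_homeomorphism m (open_cube m) n T f"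
    by blast
  moreover have "finite {x \<in> T. \<forall>i<l. proj_last n l x i = y i}" for y
    using assms[of y] \<open>T \<subseteq> A\<close> by (rule_tac finite_subset) auto
  ultimately have "m \<le> l"
    unfolding sa_homeomorphism_def by (intro open_cube_homeomorphism_le) auto
  then show "ereal (real m) \<le> ereal (real l)"
    by simp
qed

section \<open>Polynomial functions\<close>

text \<open>Polynomials as functions, \<open>d\<close> being only an upper bound for the degree.
  Degree estimates become rule applications; \<open>polyf_imp_rpoly_fun\<close> recovers a syntactic
  polynomial when monomials or a diagram are needed.\<close>

inductive polyf :: "nat \<Rightarrow> nat \<Rightarrow> ((nat \<Rightarrow> real) \<Rightarrow> real) \<Rightarrow> bool" for n where
  polyf_const: "polyf n d (\<lambda>x. c)"
| polyf_var: "i < n \<Longrightarrow> 1 \<le> d \<Longrightarrow> polyf n d (\<lambda>x. x i)"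
| polyf_add: "polyf n d f \<Longrightarrow> polyf n d g \<Longrightarrow> polyf n d (\<lambda>x. f x + g x)"
| polyf_mult: "polyf n d f \<Longrightarrow> polyf n e g \<Longrightarrow> polyf n (d + e) (\<lambda>x. f x * g x)"

lemma polyf_mono: "polyf n d f \<Longrightarrow> d \<le> e \<Longrightarrow> polyf n e f"
proof (induction arbitrary: e rule: polyf.induct)
  case (polyf_mult d f d' g)
  then have "polyf n (d + (e - d)) (\<lambda>x. f x * g x)"
    by (intro polyf.polyf_mult) auto
  then show ?case
    using polyf_mult.prems by simp
qed (auto intro: polyf.intros)

lemma polyf_mult': "polyf n d f \<Longrightarrow> polyf n e g \<Longrightarrow> d + e \<le> r \<Longrightarrow> polyf n r (\<lambda>x. f x * g x)"
  using polyf_mono polyf_mult by blast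

lemma polyf_cmult: "polyf n d f \<Longrightarrow> polyf n d (\<lambda>x. c * f x)"
  using polyf_mult[OF polyf_const[of n 0 c]] by simp

lemma polyf_uminus: "polyf n d f \<Longrightarrow> polyf n d (\<lambda>x. - f x)"
  using polyf_cmult[of n d f "-1"] by simp

lemma polyf_diff: "polyf n d f \<Longrightarrow> polyf n d g \<Longrightarrow> polyf n d (\<lambda>x. f x - g x)"
  using polyf_add[OF _ polyf_uminus] by fastforce

lemma polyf_sum: "(\<And>i. i \<in> I \<Longrightarrow> polyf n d (f i)) \<Longrightarrow> polyf n d (\<lambda>x. \<Sum>i\<in>I. f i x)"
  by (induction I rule: infinite_finite_induct) (auto intro: polyf.intros)

lemma polyf_prod: "(\<And>i. i \<in> I \<Longrightarrow> polyf n (d i) (f i)) \<Longrightarrow> polyf n (\<Sum>i\<in>I. d i) (\<lambda>x. \<Prod>i\<in>I. f i x)"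
  by (induction I rule: infinite_finite_induct) (auto intro: polyf.intros)

lemma polyf_power: "polyf n d f \<Longrightarrow> polyf n (k * d) (\<lambda>x. f x ^ k)"
  by (induction k) (auto intro: polyf.intros)

lemma continuous_on_polyf: "polyf n d f \<Longrightarrow> continuous_on A f"
  by (induction rule: polyf.induct)
    (auto intro: continuous_intros continuous_on_subset[OF continuous_on_product_coordinates])

text \<open>The clause for \<open>d = 0\<close> carries the induction through products: with
  truncated subtraction \<open>(d - 1) + e\<close> can exceed \<open>d + e - 1\<close> when
  \<open>d = 0\<close>, and there \<open>f'\<close> must be known to vanish.\<close>

lemma polyf_has_derivative:
  assumes "polyf n d f"
  shows "\<exists>f'. (d = 0 \<longrightarrow> f' = (\<lambda>x. 0)) \<and> polyf n (d - 1) f' \<and>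
    (\<forall>x. ((\<lambda>t. f (x(i := t))) has_real_derivative f' x) (at (x i)))"
  using assms
proof (induction rule: polyf.induct)
  case (polyf_const d c)
  then show ?case
    by (intro exI[of _ "\<lambda>x. 0"]) (auto intro: polyf.intros)
next
  case (polyf_var j d)
  then show ?case
    by (intro exI[of _ "\<lambda>x. if j = i then 1 else 0"]) (auto intro: polyf.intros)
next
  case (polyf_add d f g)
  then obtain f' g' where f':
    "d = 0 \<longrightarrow> f' = (\<lambda>x. 0)" "polyf n (d - 1) f'" "\<forall>x. ((\<lambda>t. f (x(i := t))) has_real_derivative f' x) (at (x i))"
    and g': "d = 0 \<longrightarrow> g' = (\<lambda>x. 0)" "polyf n (d - 1) g'" "\<forall>x. ((\<lambda>t. g (x(i := t))) has_real_derivative g' x) (at (x i))"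
    by blast
  have "((\<lambda>t. f (x(i := t)) + g (x(i := t))) has_real_derivative f' x + g' x) (at (x i))" for x
    by (intro DERIV_add f'(3)[rule_format] g'(3)[rule_format])
  then show ?case
    using f'(1,2) g'(1,2) by (intro exI[of _ "\<lambda>x. f' x + g' x"] conjI allI) (simp_all add: polyf.polyf_add fun_upd_def)
next
  case (polyf_mult d f e g)
  then obtain f' g' where f':
    "d = 0 \<longrightarrow> f' = (\<lambda>x. 0)" "polyf n (d - 1) f'" "\<forall>x. ((\<lambda>t. f (x(i := t))) has_real_derivative f' x) (at (x i))"
    and g': "e = 0 \<longrightarrow> g' = (\<lambda>x. 0)" "polyf n (e - 1) g'" "\<forall>x. ((\<lambda>t. g (x(i := t))) has_real_derivative g' x) (at (x i))"
    by blast
  have "((\<lambda>t. f (x(i := t)) * g (x(i := t))) has_real_derivative f' x * g x + g' x * f x) (at (x i))" for x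
    using DERIV_mult[OF f'(3)[rule_format, of x] g'(3)[rule_format, of x]] by simp
  moreover have "polyf n (d + e - 1) (\<lambda>x. f' x * g x)"
  proof (cases "d = 0")
    case False
    then show ?thesis
      using polyf_mult' f'(2) polyf_mult.hyps(2) by fastforce
  qed (use f'(1) in \<open>auto intro: polyf.intros\<close>)
  moreover have "polyf n (d + e - 1) (\<lambda>x. g' x * f x)"
  proof (cases "e = 0")
    case False
    then show ?thesis
      using polyf_mult' g'(2) polyf_mult.hyps(1) by fastforce
  qed (use g'(1) in \<open>auto intro: polyf.intros\<close>)
  ultimately show ?case
    using f'(1) g'(1) by (intro exI[of _ "\<lambda>x. f' x * g x + g' x * f x"]) (auto simp: fun_upd_def intro: polyf.intros)
qed

section \<open>Monomials and syntactic polynomials\<close>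

definition monom_eval :: "(nat \<Rightarrow>\<^sub>0 nat) \<Rightarrow> (nat \<Rightarrow> real) \<Rightarrow> real" where
  "monom_eval m x = (\<Prod>i\<in>Poly_Mapping.keys m. x i ^ Poly_Mapping.lookup m i)"

lemma poly_eval_eq_sum:
  "finite M \<Longrightarrow> Poly_Mapping.keys p \<subseteq> M \<Longrightarrow> poly_eval p x = (\<Sum>m\<in>M. Poly_Mapping.lookup p m * monom_eval m x)"
  unfolding poly_eval_def monom_eval_def by (rule sum.mono_neutral_left) (auto simp: in_keys_iff)

lemma monom_eval_eq_prod:
  "finite M \<Longrightarrow> Poly_Mapping.keys m \<subseteq> M \<Longrightarrow> monom_eval m x = (\<Prod>i\<in>M. x i ^ Poly_Mapping.lookup m i)"
  unfolding monom_eval_def by (rule prod.mono_neutral_left) (auto simp: in_keys_iff)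

lemma monom_degree_eq_sum:
  "finite M \<Longrightarrow> Poly_Mapping.keys m \<subseteq> M \<Longrightarrow> monom_degree m = (\<Sum>i\<in>M. Poly_Mapping.lookup m i)"
  unfolding monom_degree_def by (rule sum.mono_neutral_left) (auto simp: in_keys_iff)

lemma monom_eval_add: "monom_eval (m + m') x = monom_eval m x * monom_eval m' x"
proof -
  define M where "M = Poly_Mapping.keys m \<union> Poly_Mapping.keys m'"
  have "finite M" "Poly_Mapping.keys m \<subseteq> M" "Poly_Mapping.keys m' \<subseteq> M" "Poly_Mapping.keys (m + m') \<subseteq> M"
    using keys_add[of m m'] by (auto simp: M_def)
  then show ?thesis
    by (simp add: monom_eval_eq_prod lookup_add power_add prod.distrib)
qed

lemma monom_degree_add: "monom_degree (m + m') = monom_degree m + monom_degree m'"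
proof -
  define M where "M = Poly_Mapping.keys m \<union> Poly_Mapping.keys m'"
  have "finite M" "Poly_Mapping.keys m \<subseteq> M" "Poly_Mapping.keys m' \<subseteq> M" "Poly_Mapping.keys (m + m') \<subseteq> M"
    using keys_add[of m m'] by (auto simp: M_def)
  then show ?thesis
    by (simp add: monom_degree_eq_sum lookup_add sum.distrib)
qed

lemma poly_degree_le_iff: "poly_degree p \<le> d \<longleftrightarrow> (\<forall>m\<in>Poly_Mapping.keys p. monom_degree m \<le> d)"
  unfolding poly_degree_def by auto

lemma polyf_monom_eval:
  assumes "Poly_Mapping.keys m \<subseteq> {..<n}"
  shows "polyf n (monom_degree m) (monom_eval m)"
proof -
  have "polyf n (\<Sum>i\<in>Poly_Mapping.keys m. Poly_Mapping.lookup m i * 1)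
      (\<lambda>x. \<Prod>i\<in>Poly_Mapping.keys m. x i ^ Poly_Mapping.lookup m i)"
    using assms by (intro polyf_prod polyf_power polyf_var) auto
  then show ?thesis
    by (simp add: monom_degree_def monom_eval_def[abs_def])
qed

lemma polyf_poly_eval:
  assumes "poly_in_vars n p" "poly_degree p \<le> d"
  shows "polyf n d (poly_eval p)"
proof -
  have "polyf n d (\<lambda>x. \<Sum>m\<in>Poly_Mapping.keys p. Poly_Mapping.lookup p m * monom_eval m x)"
    using assms polyf_mono[OF polyf_monom_eval]
    by (intro polyf_sum polyf_cmult) (auto simp: poly_degree_le_iff poly_in_vars_def)
  then show ?thesis
    by (simp add: poly_eval_eq_sum[OF finite_keys order_refl, symmetric])
qed

definition rpoly_fun :: "nat \<Rightarrow> nat \<Rightarrow> ((nat \<Rightarrow> real) \<Rightarrow> real) \<Rightarrow> bool" where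
  "rpoly_fun n d f \<longleftrightarrow> (\<exists>p. poly_in_vars n p \<and> poly_degree p \<le> d \<and> (\<forall>x. poly_eval p x = f x))"

lemma rpoly_fun_monom:
  assumes "Poly_Mapping.keys m \<subseteq> {..<n}" "monom_degree m \<le> d"
  shows "rpoly_fun n d (\<lambda>x. c * monom_eval m x)"
proof -
  have "poly_eval (Poly_Mapping.single m c) x = c * monom_eval m x" for x
    by (subst poly_eval_eq_sum[of "{m}"]) auto
  then show ?thesis
    using assms unfolding rpoly_fun_def
    by (intro exI[of _ "Poly_Mapping.single m c"]) (auto simp: poly_in_vars_def poly_degree_le_iff)
qed

lemma rpoly_fun_add:
  assumes "rpoly_fun n d f" "rpoly_fun n d g"
  shows "rpoly_fun n d (\<lambda>x. f x + g x)"
proof -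
  obtain p q where p: "poly_in_vars n p" "poly_degree p \<le> d" "\<And>x. poly_eval p x = f x"
    and q: "poly_in_vars n q" "poly_degree q \<le> d" "\<And>x. poly_eval q x = g x"
    using assms unfolding rpoly_fun_def by blast
  define M where "M = Poly_Mapping.keys p \<union> Poly_Mapping.keys q"
  have M: "finite M" "Poly_Mapping.keys p \<subseteq> M" "Poly_Mapping.keys q \<subseteq> M" "Poly_Mapping.keys (p + q) \<subseteq> M"
    using keys_add[of p q] by (auto simp: M_def)
  have "poly_eval (p + q) x = poly_eval p x + poly_eval q x" for x
    using M by (simp add: poly_eval_eq_sum lookup_add distrib_right sum.distrib)
  moreover have "poly_in_vars n (p + q)" "poly_degree (p + q) \<le> d"
    using p q M(4) unfolding poly_in_vars_def poly_degree_le_iff M_def by blast+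
  ultimately show ?thesis
    unfolding rpoly_fun_def using p(3) q(3) by (intro exI[of _ "p + q"]) auto
qed

lemma rpoly_fun_zero: "rpoly_fun n d (\<lambda>x. 0)"
  using rpoly_fun_monom[of 0 n d 0] by (simp add: monom_degree_def)

lemma rpoly_fun_sum: "(\<And>i. i \<in> I \<Longrightarrow> rpoly_fun n d (f i)) \<Longrightarrow> rpoly_fun n d (\<lambda>x. \<Sum>i\<in>I. f i x)"
  by (induction I rule: infinite_finite_induct) (auto intro: rpoly_fun_add rpoly_fun_zero)

lemma rpoly_fun_mult:
  assumes "rpoly_fun n d f" "rpoly_fun n e g"
  shows "rpoly_fun n (d + e) (\<lambda>x. f x * g x)"
proof -
  obtain p q where p: "poly_in_vars n p" "poly_degree p \<le> d" "\<And>x. poly_eval p x = f x"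
    and q: "poly_in_vars n q" "poly_degree q \<le> e" "\<And>x. poly_eval q x = g x"
    using assms unfolding rpoly_fun_def by blast
  let ?h = "\<lambda>x. \<Sum>m\<in>Poly_Mapping.keys p. \<Sum>m'\<in>Poly_Mapping.keys q.
      (Poly_Mapping.lookup p m * Poly_Mapping.lookup q m') * monom_eval (m + m') x"
  have "rpoly_fun n (d + e) ?h"
  proof (intro rpoly_fun_sum rpoly_fun_monom)
    fix m m' assume "m \<in> Poly_Mapping.keys p" "m' \<in> Poly_Mapping.keys q"
    then show "Poly_Mapping.keys (m + m') \<subseteq> {..<n}" "monom_degree (m + m') \<le> d + e"
      using p q keys_add[of m m'] unfolding poly_in_vars_def poly_degree_le_iff
      by (force simp: monom_degree_add intro: add_mono)+
  qed
  moreover have "?h = (\<lambda>x. f x * g x)"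
    unfolding p(3)[symmetric] q(3)[symmetric] poly_eval_eq_sum[OF finite_keys order_refl]
    by (simp add: sum_product monom_eval_add algebra_simps)
  ultimately show ?thesis
    by simp
qed

lemma polyf_imp_rpoly_fun: "polyf n d f \<Longrightarrow> rpoly_fun n d f"
proof (induction rule: polyf.induct)
  case (polyf_const d c)
  then show ?case
    using rpoly_fun_monom[of 0 n d c] by (simp add: monom_degree_def monom_eval_def)
next
  case (polyf_var i d)
  then show ?case
    using rpoly_fun_monom[of "Poly_Mapping.single i 1" n d 1] by (simp add: monom_degree_def monom_eval_def)
qed (auto intro: rpoly_fun_add rpoly_fun_mult)

section \<open>Linear dependence, reduction of monomials and finite solution sets\<close>

lemma homogeneous_system_nontrivial:
  fixes v :: "'s \<Rightarrow> 'b \<Rightarrow> real"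
  assumes "finite B" "finite S" "card B < card S"
  shows "\<exists>c. (\<exists>s\<in>S. c s \<noteq> 0) \<and> (\<forall>b\<in>B. (\<Sum>s\<in>S. c s * v s b) = 0)"
  using assms
proof (induction B arbitrary: S v rule: finite_induct)
  case empty
  then have "S \<noteq> {}"
    by auto
  then show ?case
    by (intro exI[of _ "\<lambda>s. 1"]) auto
next
  case (insert b B)
  show ?case
  proof (cases "\<forall>s\<in>S. v s b = 0")
    case True
    have "card B < card S"
      using insert.prems insert.hyps by simp
    from insert.IH[OF insert.prems(1) this, of v] obtain c where
      "\<exists>s\<in>S. c s \<noteq> 0" "\<forall>b\<in>B. (\<Sum>s\<in>S. c s * v s b) = 0"
      by blast
    then show ?thesis
      using True by (intro exI[of _ c]) simp
  next
    case False
    then obtain r where r: "r \<in> S" "v r b \<noteq> 0"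
      by blast
    \<comment> \<open>Gaussian elimination: these are the coefficients after equation
      \<open>b\<close> has been used to eliminate the unknown \<open>r\<close>; \<open>c'\<close>
      restores the value of \<open>r\<close>.\<close>
    define v' where "v' s b' = v s b' - v s b / v r b * v r b'" for s b'
    have "finite (S - {r})" "card B < card (S - {r})"
      using insert.prems insert.hyps r by simp_all
    from insert.IH[OF this, of v'] obtain c where c: "\<exists>s\<in>S - {r}. c s \<noteq> 0"
      "\<forall>b'\<in>B. (\<Sum>s\<in>S - {r}. c s * v' s b') = 0"
      by blast
    define c' where "c' = c(r := - (\<Sum>s\<in>S - {r}. c s * v s b) / v r b)"
    have split: "(\<Sum>s\<in>S. c' s * v s b') = c' r * v r b' + (\<Sum>s\<in>S - {r}. c s * v s b')" for b'
      unfolding sum.remove[OF insert.prems(1) r(1)] by (simp add: c'_def)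
    have "(\<Sum>s\<in>S. c' s * v s b') = (\<Sum>s\<in>S - {r}. c s * v' s b')" for b'
      unfolding split
      by (simp add: c'_def v'_def right_diff_distrib sum_subtractf sum_distrib_left divide_inverse mult_ac)
    moreover have "v' s b = 0" for s
      using r(2) by (simp add: v'_def)
    ultimately have "\<forall>b'\<in>insert b B. (\<Sum>s\<in>S. c' s * v s b') = 0"
      using c(2) by simp
    moreover have "\<exists>s\<in>S. c' s \<noteq> 0"
      using c(1) by (auto simp: c'_def)
    ultimately show ?thesis
      by blast
  qed
qed

text \<open>Linear span modulo functions vanishing on \<open>V\<close>; this replaces computation in
  a quotient of the polynomial ring.\<close>

definition spanned_on :: "'x set \<Rightarrow> ('b \<Rightarrow> 'x \<Rightarrow> real) \<Rightarrow> 'b set \<Rightarrow> ('x \<Rightarrow> real) \<Rightarrow> bool" where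
  "spanned_on V r B f \<longleftrightarrow> (\<exists>c. \<forall>x\<in>V. f x = (\<Sum>b\<in>B. c b * r b x))"

lemma spanned_on_add: "spanned_on V r B f \<Longrightarrow> spanned_on V r B g \<Longrightarrow> spanned_on V r B (\<lambda>x. f x + g x)"
  unfolding spanned_on_def
proof (elim exE)
  fix c c' assume "\<forall>x\<in>V. f x = (\<Sum>b\<in>B. c b * r b x)" "\<forall>x\<in>V. g x = (\<Sum>b\<in>B. c' b * r b x)"
  then show "\<exists>c. \<forall>x\<in>V. f x + g x = (\<Sum>b\<in>B. c b * r b x)"
    by (intro exI[of _ "\<lambda>b. c b + c' b"]) (simp add: distrib_right sum.distrib)
qed

lemma spanned_on_cmult: "spanned_on V r B f \<Longrightarrow> spanned_on V r B (\<lambda>x. a * f x)"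
  unfolding spanned_on_def
proof (elim exE)
  fix c assume "\<forall>x\<in>V. f x = (\<Sum>b\<in>B. c b * r b x)"
  then show "\<exists>c. \<forall>x\<in>V. a * f x = (\<Sum>b\<in>B. c b * r b x)"
    by (intro exI[of _ "\<lambda>b. a * c b"]) (simp add: sum_distrib_left mult.assoc)
qed

lemma spanned_on_sum:
  assumes "\<And>i. i \<in> I \<Longrightarrow> spanned_on V r B (f i)"
  shows "spanned_on V r B (\<lambda>x. \<Sum>i\<in>I. f i x)"
proof -
  have "spanned_on V r B (\<lambda>x. 0)"
    unfolding spanned_on_def by (intro exI[of _ "\<lambda>b. 0"]) simp
  then show ?thesis
    using assms by (induction I rule: infinite_finite_induct) (auto intro: spanned_on_add)
qed

lemma spanned_on_base: "finite B \<Longrightarrow> b \<in> B \<Longrightarrow> spanned_on V r B (r b)"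
  unfolding spanned_on_def by (intro exI[of _ "\<lambda>b'. if b' = b then 1 else 0"]) (simp add: if_distrib[of "\<lambda>u. u * _"] sum.delta' cong: if_cong)

lemma spanned_on_cong: "spanned_on V r B f \<Longrightarrow> (\<And>x. x \<in> V \<Longrightarrow> g x = f x) \<Longrightarrow> spanned_on V r B g"
  unfolding spanned_on_def by (simp cong: ball_cong)

text \<open>Every monomial reduces, by the equations \<open>x i ^ e = q i x\<close> of lower degree on the right, to a
  combination of the finitely many monomials with all exponents below \<open>e\<close>.\<close>

lemma polyf_spanned_by_reduced_monomials:
  assumes eq: "\<And>i x. i < k \<Longrightarrow> x \<in> V \<Longrightarrow> x i ^ e = q i x"
    and q: "\<And>i. i < k \<Longrightarrow> polyf n (e - 1) (q i)" and "1 \<le> e"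
    and fixed: "\<And>i x. k \<le> i \<Longrightarrow> x \<in> V \<Longrightarrow> x i = y i"
    and "polyf n N f"
  shows "spanned_on V (\<lambda>a x. \<Prod>i<k. x i ^ a i) (PiE {..<k} (\<lambda>_. {..<e})) f"
  using \<open>polyf n N f\<close>
proof (induction N arbitrary: f rule: less_induct)
  case (less N)
  let ?sp = "spanned_on V (\<lambda>a x. \<Prod>i<k. x i ^ a i) (PiE {..<k} (\<lambda>_. {..<e}))"
  have mon: "?sp (monom_eval m)" if m: "Poly_Mapping.keys m \<subseteq> {..<n}" "monom_degree m \<le> N" for m
  proof (cases "\<exists>i<k. e \<le> Poly_Mapping.lookup m i")
    case True
    then obtain i where i: "i < k" "e \<le> Poly_Mapping.lookup m i"
      by blast
    define m' where "m' = m - Poly_Mapping.single i e"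
    have m_eq: "m = Poly_Mapping.single i e + m'"
      using i(2) by (intro poly_mapping_eqI) (auto simp: m'_def lookup_add lookup_minus lookup_single when_def)
    have deg: "monom_degree m = e + monom_degree m'"
      using \<open>1 \<le> e\<close> by (subst m_eq, subst monom_degree_add) (simp add: monom_degree_def)
    have "Poly_Mapping.keys m' \<subseteq> Poly_Mapping.keys m"
      by (auto simp: m'_def in_keys_iff lookup_minus)
    then have "polyf n (e - 1 + monom_degree m') (\<lambda>x. q i x * monom_eval m' x)"
      using m(1) by (intro polyf_mult q[OF i(1)] polyf_monom_eval) auto
    \<comment> \<open>Replacing \<open>x i ^ e\<close> by \<open>q i x\<close> lowers the degree
      bound, so the induction hypothesis applies.\<close>
    then have "?sp (\<lambda>x. q i x * monom_eval m' x)"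
      using less.IH[of "e - 1 + monom_degree m'"] deg m(2) \<open>1 \<le> e\<close> by simp
    moreover have "monom_eval m x = q i x * monom_eval m' x" if "x \<in> V" for x
      using \<open>1 \<le> e\<close> eq[OF i(1) that]
      by (subst m_eq, subst monom_eval_add) (simp add: monom_eval_def)
    ultimately show ?thesis
      by (rule spanned_on_cong)
  next
    case False
    \<comment> \<open>The exponents of the first \<open>k\<close> variables are already reduced; the
      other variables are constant on \<open>V\<close> and contribute only a scalar.\<close>
    define a where "a = restrict (Poly_Mapping.lookup m) {..<k}"
    have "a \<in> PiE {..<k} (\<lambda>_. {..<e})"
      using False by (auto simp: a_def not_le)
    then have "?sp (\<lambda>x. (\<Prod>i\<in>{k..<max n k}. y i ^ Poly_Mapping.lookup m i) * (\<Prod>i<k. x i ^ a i))"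
      by (intro spanned_on_cmult spanned_on_base[of _ a V "\<lambda>a x. \<Prod>i<k. x i ^ a i"]) (auto intro: finite_PiE)
    moreover have "monom_eval m x = (\<Prod>i\<in>{k..<max n k}. y i ^ Poly_Mapping.lookup m i) * (\<Prod>i<k. x i ^ a i)"
      if "x \<in> V" for x
    proof -
      have "Poly_Mapping.keys m \<subseteq> {..<k} \<union> {k..<max n k}"
        using m(1) by auto
      then have "monom_eval m x = (\<Prod>i\<in>{..<k} \<union> {k..<max n k}. x i ^ Poly_Mapping.lookup m i)"
        by (intro monom_eval_eq_prod) auto
      also have "\<dots> = (\<Prod>i<k. x i ^ Poly_Mapping.lookup m i) * (\<Prod>i\<in>{k..<max n k}. x i ^ Poly_Mapping.lookup m i)"
        by (intro prod.union_disjoint) auto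
      also have "(\<Prod>i<k. x i ^ Poly_Mapping.lookup m i) = (\<Prod>i<k. x i ^ a i)"
        by (simp add: a_def)
      also have "(\<Prod>i\<in>{k..<max n k}. x i ^ Poly_Mapping.lookup m i) = (\<Prod>i\<in>{k..<max n k}. y i ^ Poly_Mapping.lookup m i)"
        using fixed[OF _ that] by (intro prod.cong) auto
      finally show ?thesis
        by simp
    qed
    ultimately show ?thesis
      by (rule spanned_on_cong)
  qed
  obtain p where p: "poly_in_vars n p" "poly_degree p \<le> N" "\<And>x. poly_eval p x = f x"
    using polyf_imp_rpoly_fun[OF less.prems] unfolding rpoly_fun_def by blast
  have "?sp (\<lambda>x. \<Sum>m\<in>Poly_Mapping.keys p. Poly_Mapping.lookup p m * monom_eval m x)"
    using p(1,2) by (intro spanned_on_sum spanned_on_cmult mon) (auto simp: poly_in_vars_def poly_degree_le_iff)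
  then show ?case
    by (simp add: poly_eval_eq_sum[OF finite_keys order_refl, symmetric] p(3))
qed

text \<open>On \<open>V\<close> all powers of a coordinate lie in the span of \<open>card B\<close>
  functions, so the first \<open>card B + 1\<close> of them are linearly dependent. The coordinate
  is thus a root of a fixed nonzero univariate polynomial and takes finitely many values.\<close>

theorem finite_solutions:
  assumes eq: "\<And>i x. i < k \<Longrightarrow> x \<in> V \<Longrightarrow> x i ^ e = q i x"
    and q: "\<And>i. i < k \<Longrightarrow> polyf n (e - 1) (q i)" and "1 \<le> e" and "k \<le> n"
    and fixed: "\<And>i x. k \<le> i \<Longrightarrow> x \<in> V \<Longrightarrow> x i = y i"
  shows "finite V"
proof -
  define r where "r a x = (\<Prod>i<k. x i ^ a i)" for a and x :: "nat \<Rightarrow> real"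
  define B where "B = PiE {..<k} (\<lambda>_. {..<e})"
  have "finite B"
    unfolding B_def by (intro finite_PiE) auto
  have "finite ((\<lambda>x. x i) ` V)" if i: "i < k" for i
  proof -
    have "spanned_on V r B (\<lambda>x. x i ^ s)" for s
    proof -
      have "polyf n (s * 1) (\<lambda>x. x i ^ s)"
        using \<open>k \<le> n\<close> i by (intro polyf_power polyf_var) auto
      then show ?thesis
        unfolding r_def[abs_def] B_def
        by (rule polyf_spanned_by_reduced_monomials[where q=q and y=y and n=n, rotated 4])
          (use eq q \<open>1 \<le> e\<close> fixed in auto)
    qed
    then obtain v where v: "\<And>s x. x \<in> V \<Longrightarrow> x i ^ s = (\<Sum>b\<in>B. v s b * r b x)"
      unfolding spanned_on_def by metis
    obtain c where c: "\<exists>s\<in>{..card B}. c s \<noteq> 0" "\<forall>b\<in>B. (\<Sum>s\<le>card B. c s * v s b) = 0"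
      using homogeneous_system_nontrivial[OF \<open>finite B\<close>, of "{..card B}" v] by auto
    have "(\<Sum>s\<le>card B. c s * x i ^ s) = 0" if "x \<in> V" for x
    proof -
      have "(\<Sum>s\<le>card B. c s * x i ^ s) = (\<Sum>s\<le>card B. \<Sum>b\<in>B. c s * v s b * r b x)"
        by (simp add: v[OF that] sum_distrib_left mult.assoc)
      also have "\<dots> = (\<Sum>b\<in>B. (\<Sum>s\<le>card B. c s * v s b) * r b x)"
        by (subst sum.swap) (simp add: sum_distrib_right)
      finally show ?thesis
        using c(2) by simp
    qed
    then have "(\<lambda>x. x i) ` V \<subseteq> {z. (\<Sum>s\<le>card B. c s * z ^ s) = 0}"
      by auto
    moreover have "finite {z. (\<Sum>s\<le>card B. c s * z ^ s) = 0}"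
      using polyfun_finite_roots[of c "card B"] c(1) by auto
    ultimately show ?thesis
      by (rule finite_subset)
  qed
  then have "finite (PiE {..<k} (\<lambda>i. (\<lambda>x. x i) ` V))"
    by (intro finite_PiE) auto
  moreover have "(\<lambda>x. restrict x {..<k}) ` V \<subseteq> PiE {..<k} (\<lambda>i. (\<lambda>x. x i) ` V)"
    by (auto intro!: restrict_PiE_iff[THEN iffD2])
  moreover have "inj_on (\<lambda>x. restrict x {..<k}) V"
  proof (rule inj_onI, rule ext)
    fix x x' i assume *: "x \<in> V" "x' \<in> V" "restrict x {..<k} = restrict x' {..<k}"
    show "x i = x' i"
    proof (cases "i < k")
      case True
      then show ?thesis
        using fun_cong[OF *(3), of i] by (simp only: restrict_apply lessThan_iff if_True)
    next
      case False
      then show ?thesis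
        using *(1,2) fixed[of i x] fixed[of i x'] by (simp only: not_less)
    qed
  qed
  ultimately show ?thesis
    using finite_imageD finite_subset by blast
qed

section \<open>The critical set of a perturbed product\<close>

lemma Rn_eq: "Rn n = {x. \<forall>i\<ge>n. x i = 0}"
  by (simp add: topspace_Euclidean_space)

lemma closed_Rn: "closed (Rn n)"
proof -
  have "closed (\<Inter>i\<in>{n..}. {x :: nat \<Rightarrow> real. x i = 0})"
    by (intro closed_INT ballI closed_Collect_eq continuous_on_const continuous_on_product_coordinates)
  also have "(\<Inter>i\<in>{n..}. {x :: nat \<Rightarrow> real. x i = 0}) = Rn n"
    by (auto simp: Rn_eq)
  finally show ?thesis .
qed

lemma continuous_on_coordinate [continuous_intros]: "continuous_on A (\<lambda>x :: nat \<Rightarrow> real. x i)"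
  by (rule continuous_on_subset[OF continuous_on_product_coordinates]) simp

lemma continuous_on_eucl_dist: "continuous_on A (\<lambda>x. eucl_dist n x z)"
  unfolding eucl_dist_def L2_set_def by (intro continuous_intros)

lemma compact_Rn_ball: "compact {x \<in> Rn n. (\<Sum>i<n. (x i)\<^sup>2) \<le> R}"
proof -
  \<comment> \<open>The summand 1 gives \<open>1 \<le> r\<close>, hence
    \<open>R \<le> r \<le> r ^ 2\<close>, and the box of half-width \<open>r\<close> contains the
    ball.\<close>
  define r where "r = max 0 R + 1"
  define c where "c i = (if i < n then r else 0)" for i
  have bd: "\<bar>x i\<bar> \<le> c i" if "x \<in> Rn n" "(\<Sum>i<n. (x i)\<^sup>2) \<le> R" for x i
  proof (cases "i < n")
    case True
    have "\<bar>x i\<bar>\<^sup>2 \<le> (\<Sum>i<n. (x i)\<^sup>2)"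
      using True by (simp, intro member_le_sum) auto
    also have "\<dots> \<le> r\<^sup>2"
    proof -
      have "R \<le> r" "1 \<le> r"
        by (auto simp: r_def)
      then show ?thesis
        using that(2) self_le_power[of r 2] by auto
    qed
    finally show ?thesis
      using True by (simp add: c_def r_def power2_le_iff_abs_le)
  qed (use that(1) in \<open>simp add: Rn_eq c_def\<close>)
  have bd': "- c i \<le> x i \<and> x i \<le> c i" if "x \<in> Rn n" "(\<Sum>i<n. (x i)\<^sup>2) \<le> R" for x i
    using bd[OF that, of i] by linarith
  have "{x \<in> Rn n. (\<Sum>i<n. (x i)\<^sup>2) \<le> R} =
      {x. \<forall>i. - c i \<le> x i \<and> x i \<le> c i} \<inter> (Rn n \<inter> {x. (\<Sum>i<n. (x i)\<^sup>2) \<le> R})"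
    using bd' by blast
  moreover have "closed {x :: nat \<Rightarrow> real. (\<Sum>i<n. (x i)\<^sup>2) \<le> R}"
    by (intro closed_Collect_le continuous_intros)
  ultimately show ?thesis
    by (simp only:) (intro compact_Int_closed compact_box_fun closed_Int closed_Rn)
qed

text \<open>\<open>C\<close> need not be closed, so centres are found in its closure at scale
  \<open>\<epsilon> / 2\<close> and then moved into \<open>C\<close>. They have to lie in
  \<open>C\<close> because the strict sign conditions are later evaluated at them.\<close>

lemma finite_net:
  assumes "C \<subseteq> K" "compact K" "\<epsilon> > 0"
  shows "\<exists>N. finite N \<and> N \<subseteq> C \<and> (\<forall>z\<in>C. \<exists>w\<in>N. eucl_dist n z w \<le> \<epsilon>)"
proof -
  have "open {x. eucl_dist n x w < \<epsilon> / 2}" for w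
    by (intro open_Collect_less continuous_on_eucl_dist continuous_on_const)
  moreover have "closure C \<subseteq> K"
    using assms by (simp add: closure_minimal compact_imp_closed)
  then have "compact (closure C)"
    using \<open>compact K\<close> compact_closure by (metis closed_closure compact_Int_closed inf.absorb2)
  moreover have "closure C \<subseteq> (\<Union>y\<in>closure C. {x. eucl_dist n x y < \<epsilon> / 2})"
    using \<open>\<epsilon> > 0\<close> by (auto simp: eucl_dist_def L2_set_def)
  ultimately obtain M where M: "M \<subseteq> closure C" "finite M" "closure C \<subseteq> (\<Union>y\<in>M. {x. eucl_dist n x y < \<epsilon> / 2})"
    by (metis (no_types, lifting) compactE_image)
  have "\<exists>w\<in>C. eucl_dist n w y < \<epsilon> / 2" if "y \<in> M" for y
  proof -
    have "open {x. eucl_dist n x y < \<epsilon> / 2}" "y \<in> {x. eucl_dist n x y < \<epsilon> / 2}"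
      using \<open>\<epsilon> > 0\<close> by (auto simp: eucl_dist_def L2_set_def intro!: open_Collect_less continuous_intros)
    then have "{x. eucl_dist n x y < \<epsilon> / 2} \<inter> C \<noteq> {}"
      using M(1) that by (subst open_Int_closure_eq_empty[symmetric]) auto
    then show ?thesis
      by blast
  qed
  then obtain h where h: "\<And>y. y \<in> M \<Longrightarrow> h y \<in> C \<and> eucl_dist n (h y) y < \<epsilon> / 2"
    by metis
  have tri: "eucl_dist n x z \<le> eucl_dist n x y + eucl_dist n z y" for x y z
  proof -
    have "L2_set (\<lambda>i. (x i - y i) + (y i - z i)) {..<n} \<le> eucl_dist n x y + eucl_dist n y z"
      unfolding eucl_dist_def by (rule L2_set_triangle_ineq)
    moreover have "eucl_dist n y z = eucl_dist n z y"
      by (simp add: eucl_dist_def L2_set_def power2_commute)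
    ultimately show ?thesis
      by (simp add: eucl_dist_def)
  qed
  show ?thesis
  proof (intro exI[of _ "h ` M"] conjI ballI)
    show "\<exists>w\<in>h ` M. eucl_dist n z w \<le> \<epsilon>" if z: "z \<in> C" for z
    proof -
      obtain y where y: "y \<in> M" "eucl_dist n z y < \<epsilon> / 2"
        using M(3) z closure_subset by blast
      then have "eucl_dist n z (h y) \<le> \<epsilon>"
        using h[OF y(1)] tri[of z "h y" y] by linarith
      then show ?thesis
        using y(1) by blast
    qed
  qed (use M(2) h in auto)
qed

lemma finite_positive_lower_bound:
  fixes P :: "real set"
  assumes "finite P" "\<And>u. u \<in> P \<Longrightarrow> 0 < u"
  shows "\<exists>\<delta>>0. \<forall>u\<in>P. \<delta> < u"
proof (intro exI[of _ "Min (insert 1 P) / 2"] conjI ballI)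
  show pos: "Min (insert 1 P) / 2 > 0"
    using assms by simp
  show "Min (insert 1 P) / 2 < u" if "u \<in> P" for u
  proof -
    have "Min (insert 1 P) \<le> u"
      using assms(1) that by (intro Min_le) auto
    then show ?thesis
      using pos by linarith
  qed
qed

section \<open>Relaxed sign conditions\<close>

definition sign_set :: "nat \<Rightarrow> nat \<Rightarrow> (nat \<Rightarrow> (nat \<Rightarrow> real) \<Rightarrow> real) \<Rightarrow> (nat \<Rightarrow> real) \<Rightarrow> (nat \<Rightarrow> real) set" where
  "sign_set n b p \<sigma> = {x \<in> Rn n. \<forall>j<b. sgn (p j x) = \<sigma> j}"

text \<open>\<open>K\<close> collects the points of the ball that satisfy the shrunk inequalities
  but have distance at least \<open>\<epsilon>\<close> from the basic set. A zero on
  \<open>K\<close> of \<open>h\<close>, the sum of the squared equations, would lie in the basic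
  set, at distance 0 from itself. So \<open>h\<close> is bounded below on the compact
  \<open>K\<close> by some \<open>\<mu> > 0\<close>, and a small \<open>\<eta>\<close> keeps relaxed
  points out of \<open>K\<close>.\<close>

lemma relaxed_sign_set_near:
  assumes p: "\<And>j. j < b \<Longrightarrow> polyf n d (p j)" and \<sigma>: "\<And>j. j < b \<Longrightarrow> \<sigma> j \<in> {0, 1, -1}"
    and "\<epsilon> > 0" "\<delta> > 0"
  shows "\<exists>\<eta>>0. \<forall>x\<in>Rn n. (\<Sum>i<n. (x i)\<^sup>2) \<le> R \<longrightarrow>
    (\<forall>j<b. if \<sigma> j = 0 then (p j x)\<^sup>2 \<le> \<eta> else \<delta> \<le> \<sigma> j * p j x) \<longrightarrow>
    (\<exists>z\<in>sign_set n b p \<sigma>. eucl_dist n x z \<le> \<epsilon>)"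
proof -
  define K where "K = {x \<in> Rn n. (\<Sum>i<n. (x i)\<^sup>2) \<le> R} \<inter>
    ((\<Inter>j\<in>{j. j < b \<and> \<sigma> j \<noteq> 0}. {x. \<delta> \<le> \<sigma> j * p j x}) \<inter> (\<Inter>z\<in>sign_set n b p \<sigma>. {x. \<epsilon> \<le> eucl_dist n x z}))"
  have "closed {x. \<delta> \<le> \<sigma> j * p j x}" if "j < b" for j
    by (intro closed_Collect_le continuous_intros continuous_on_polyf[OF p[OF that]])
  moreover have "closed {x. \<epsilon> \<le> eucl_dist n x z}" for z
    by (intro closed_Collect_le continuous_intros continuous_on_eucl_dist)
  ultimately have "compact K"
    unfolding K_def by (intro compact_Int_closed compact_Rn_ball closed_Int closed_INT) auto
  define h where "h x = (\<Sum>j<b. if \<sigma> j = 0 then (p j x)\<^sup>2 else 0)" for x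
  have "polyf n (2 * d) (\<lambda>x. if \<sigma> j = 0 then (p j x)\<^sup>2 else 0)" if "j < b" for j
    using polyf_power[OF p[OF that], of 2] by (cases "\<sigma> j = 0") (auto intro: polyf_const)
  then have "polyf n (2 * d) h"
    unfolding h_def by (intro polyf_sum) auto
  then have cont: "continuous_on K h"
    by (rule continuous_on_polyf)
  have h_pos: "h x > 0" if x: "x \<in> K" for x
  proof (rule ccontr)
    assume "\<not> h x > 0"
    moreover have "h x \<ge> 0"
      unfolding h_def by (intro sum_nonneg) auto
    ultimately have "h x = 0"
      by simp
    then have z: "\<forall>j\<in>{..<b}. (if \<sigma> j = 0 then (p j x)\<^sup>2 else 0) = 0"
      unfolding h_def by (subst (asm) sum_nonneg_eq_0_iff) auto
    have "sgn (p j x) = \<sigma> j" if j: "j < b" for j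
    proof (cases "\<sigma> j = 0")
      case True
      then show ?thesis
        using z[rule_format, of j] j by simp
    next
      case False
      then have "0 < \<sigma> j * p j x"
        using x j \<open>\<delta> > 0\<close> unfolding K_def by fastforce
      then show ?thesis
        using \<sigma>[OF j] False by (auto simp: sgn_if)
    qed
    then have "x \<in> sign_set n b p \<sigma>"
      using x by (simp add: sign_set_def K_def)
    then have "\<epsilon> \<le> eucl_dist n x x"
      using x unfolding K_def by blast
    then show False
      using \<open>\<epsilon> > 0\<close> by (simp add: eucl_dist_def L2_set_def)
  qed
  obtain \<mu> where \<mu>: "\<mu> > 0" "\<And>x. x \<in> K \<Longrightarrow> \<mu> \<le> h x"
  proof (cases "K = {}")
    case True
    then show ?thesis
      using that[of 1] by simp
  next
    case False
    then obtain x0 where "x0 \<in> K" "\<And>x. x \<in> K \<Longrightarrow> h x0 \<le> h x"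
      using continuous_attains_inf[OF \<open>compact K\<close> _ cont] by blast
    then show ?thesis
      using that[of "h x0"] h_pos by blast
  qed
  show ?thesis
  \<comment> \<open>At most \<open>b\<close> squares of this size add up to less than
    \<open>\<mu>\<close>, also when \<open>b = 0\<close>.\<close>
  proof (intro exI[of _ "\<mu> / (real b + 1)"] conjI ballI impI)
    show "\<mu> / (real b + 1) > 0"
      using \<mu>(1) by simp
    fix x assume x: "x \<in> Rn n" "(\<Sum>i<n. (x i)\<^sup>2) \<le> R"
      and rel: "\<forall>j<b. if \<sigma> j = 0 then (p j x)\<^sup>2 \<le> \<mu> / (real b + 1) else \<delta> \<le> \<sigma> j * p j x"
    have "h x \<le> (\<Sum>j<b. \<mu> / (real b + 1))"
      unfolding h_def using rel \<mu>(1) by (intro sum_mono) auto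
    also have "\<dots> = \<mu> * (real b / (real b + 1))"
      by simp
    also have "\<dots> < \<mu> * 1"
      using \<mu>(1) by (intro mult_strict_left_mono) auto
    finally have "x \<notin> K"
      using \<mu>(2)[of x] by auto
    then obtain z where "z \<in> sign_set n b p \<sigma>" "\<not> \<epsilon> \<le> eucl_dist n x z"
      using x rel unfolding K_def by auto
    then show "\<exists>z\<in>sign_set n b p \<sigma>. eucl_dist n x z \<le> \<epsilon>"
      by (intro bexI[of _ z]) auto
  qed
qed

section \<open>Critical points in the fibres of the projection\<close>

lemma polyf_partial_derivative:
  assumes "polyf n d f" "d \<ge> 1"
  obtains f' where "\<And>i. polyf n (d - 1) (f' i)"
    "\<And>i x. ((\<lambda>t. f (x(i := t))) has_real_derivative f' i x) (at (x i))"
proof -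
  have "\<exists>f'. \<forall>i. polyf n (d - 1) (f' i) \<and> (\<forall>x. ((\<lambda>t. f (x(i := t))) has_real_derivative f' i x) (at (x i)))"
    using polyf_has_derivative[OF assms(1)] by (intro choice allI) blast
  then show ?thesis
    using that by blast
qed

lemma polyf_isCont_coordinate: "polyf n d f \<Longrightarrow> isCont (\<lambda>t. f (x(i := t))) (x i)"
  using polyf_has_derivative[of n d f i] DERIV_isCont by blast

lemma eucl_dist_proj_last_le:
  assumes "l \<le> n"
  shows "eucl_dist l (proj_last n l x) (proj_last n l y) \<le> eucl_dist n x y"
proof -
  have "(\<Sum>i<l. (proj_last n l x i - proj_last n l y i)\<^sup>2) = (\<Sum>i<l. (x (n - l + i) - y (n - l + i))\<^sup>2)"
    by (simp add: proj_last_def)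
  also have "\<dots> = (\<Sum>j\<in>(\<lambda>i. n - l + i) ` {..<l}. (x j - y j)\<^sup>2)"
    by (subst sum.reindex) (auto simp: inj_on_def)
  also have "\<dots> \<le> (\<Sum>j<n. (x j - y j)\<^sup>2)"
    using assms by (intro sum_mono2) auto
  finally show ?thesis
    by (simp add: eucl_dist_def L2_set_def)
qed

text \<open>\<open>G\<close> vanishes on the boundary of \<open>{f > 0}\<close>, so a maximum of \<open>G - t * sum (x i ^ e)\<close> on a fibre
  at which \<open>G\<close> is positive is a critical point in the fibre direction.\<close>

lemma critical_points:
  assumes f: "\<And>j. j < b \<Longrightarrow> polyf n d (f j)" and "k \<le> n" and "even e" "e > b * d" "b * d \<ge> 1"
    and "t > 0" "\<tau> > 0"
    and ball: "\<And>x. x \<in> Rn n \<Longrightarrow> (\<And>j. j < b \<Longrightarrow> 0 \<le> f j x) \<Longrightarrow> (\<Sum>i<n. (x i)\<^sup>2) \<le> R"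
  shows "\<exists>H. polyf n (2 * (e - 1)) H \<and>
    (\<forall>w\<in>Rn n. (\<forall>j<b. 0 \<le> f j w) \<longrightarrow> \<tau> + t * (\<Sum>i<k. w i ^ e) \<le> (\<Prod>j<b. f j w) \<longrightarrow>
      (\<exists>x\<in>Rn n. (\<forall>j<b. 0 < f j x) \<and> \<tau> \<le> (\<Prod>j<b. f j x) \<and> H x = 0 \<and> (\<forall>i\<ge>k. x i = w i))) \<and>
    (\<forall>y. finite {x. H x = 0 \<and> (\<forall>i\<ge>k. x i = y i)})"
proof -
  define G where "G x = (\<Prod>j<b. f j x)" for x
  have G: "polyf n (b * d) G"
    using polyf_prod[of "{..<b}" n "\<lambda>_. d" f] f unfolding G_def by simp
  obtain G' where G': "\<And>i. polyf n (b * d - 1) (G' i)"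
    "\<And>i x. ((\<lambda>u. G (x(i := u))) has_real_derivative G' i x) (at (x i))"
    using polyf_partial_derivative[OF G \<open>b * d \<ge> 1\<close>] by blast
  define F where "F x = G x - t * (\<Sum>i<k. x i ^ e)" for x
  define F' where "F' i x = G' i x - t * (real e * x i ^ (e - 1))" for i x
  have "e \<ge> 2"
    using assms(4,5) by linarith
  have F: "polyf n (b * d + e) F"
    unfolding F_def using \<open>k \<le> n\<close>
    by (intro polyf_diff polyf_mono[OF G] polyf_cmult polyf_sum polyf_mono[OF polyf_power[OF polyf_var[of _ n 1]]]) auto
  have F': "((\<lambda>u. F (x(i := u))) has_real_derivative F' i x) (at (x i))" if "i < k" for i x
  proof -
    have "(\<Sum>j<k. (x(i := u)) j ^ e) = u ^ e + (\<Sum>j\<in>{..<k} - {i}. x j ^ e)" for u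
      using that by (subst sum.remove[of _ i]) auto
    then have eq: "(\<lambda>u. F (x(i := u))) = (\<lambda>u. G (x(i := u)) - t * (u ^ e + (\<Sum>j\<in>{..<k} - {i}. x j ^ e)))"
      unfolding F_def by simp
    show ?thesis
      unfolding eq F'_def by (rule derivative_eq_intros G'(2) refl | simp)+
  qed
  \<comment> \<open>One sum of squares packs the \<open>k\<close> critical equations into a single
    condition, so the number of conditions does not grow with \<open>k\<close>.\<close>
  define H where "H x = (\<Sum>i<k. (F' i x)\<^sup>2)" for x
  have H_iff: "H x = 0 \<longleftrightarrow> (\<forall>i<k. F' i x = 0)" for x
    unfolding H_def by (subst sum_nonneg_eq_0_iff) auto
  have "polyf n (e - 1) (F' i)" if "i < k" for i
    unfolding F'_def using that \<open>k \<le> n\<close> \<open>e > b * d\<close>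
    by (intro polyf_diff polyf_mono[OF G'(1)] polyf_cmult polyf_mono[OF polyf_power[OF polyf_var[of _ n 1]]]) auto
  then have H: "polyf n (2 * (e - 1)) H"
    unfolding H_def by (intro polyf_sum polyf_power) auto
  show ?thesis
  proof (intro exI[of _ H] conjI ballI impI allI)
    show "polyf n (2 * (e - 1)) H"
      by (rule H)
    fix w assume w: "w \<in> Rn n" "\<forall>j<b. 0 \<le> f j w" "\<tau> + t * (\<Sum>i<k. w i ^ e) \<le> (\<Prod>j<b. f j w)"
    \<comment> \<open>The part of the fibre through \<open>w\<close> where all \<open>f j\<close>
      are nonnegative. The ball follows from these constraints by \<open>ball\<close> and is written
      out to exhibit compactness.\<close>
    define M where "M = {x \<in> Rn n. (\<Sum>i<n. (x i)\<^sup>2) \<le> R} \<inter>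
      ((\<Inter>j\<in>{..<b}. {x. 0 \<le> f j x}) \<inter> (\<Inter>i\<in>{k..}. {x. x i = w i}))"
    have "closed {x. 0 \<le> f j x}" if "j < b" for j
      by (intro closed_Collect_le continuous_on_const continuous_on_polyf[OF f[OF that]])
    moreover have "closed {x :: nat \<Rightarrow> real. x i = w i}" for i
      by (intro closed_Collect_eq continuous_intros)
    ultimately have "compact M"
      unfolding M_def by (intro compact_Int_closed compact_Rn_ball closed_Int closed_INT) auto
    moreover have M_iff: "x \<in> M \<longleftrightarrow> x \<in> Rn n \<and> (\<forall>j<b. 0 \<le> f j x) \<and> (\<forall>i\<ge>k. x i = w i)" for x
      unfolding M_def using ball by auto
    then have "w \<in> M"
      using w by simp
    ultimately obtain x where x: "x \<in> M" "\<And>z. z \<in> M \<Longrightarrow> F z \<le> F x"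
      using continuous_attains_sup[of M F] continuous_on_polyf[OF F] by blast
    \<comment> \<open>The subtracted powers have even exponent, so \<open>F \<le> G\<close> and the
      maximum of \<open>F\<close> forces \<open>\<tau> \<le> G x\<close>. Hence no factor vanishes
      at \<open>x\<close>.\<close>
    have "\<tau> \<le> F w"
      using w(3) by (simp add: F_def G_def)
    also have "\<dots> \<le> F x"
      by (rule x(2)) fact
    also have "\<dots> \<le> G x"
      unfolding F_def using \<open>t > 0\<close> \<open>even e\<close> by (simp add: sum_nonneg zero_le_even_power)
    finally have Gx: "\<tau> \<le> G x" .
    have fx: "0 < f j x" if "j < b" for j
    proof (rule ccontr)
      assume "\<not> 0 < f j x"
      then have "f j x = 0"
        using x(1) that unfolding M_iff by force
      then have "G x = 0"
        unfolding G_def using that by (intro prod_zero) auto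
      then show False
        using Gx \<open>\<tau> > 0\<close> by simp
    qed
    have "F' i x = 0" if i: "i < k" for i
    proof -
      \<comment> \<open>Positivity of the factors is an open condition, so small changes of a
        coordinate \<open>i < k\<close> stay in \<open>M\<close> and \<open>x\<close> is a local
        maximum in that coordinate.\<close>
      have "\<forall>j\<in>{..<b}. \<forall>\<^sub>F u in at (x i). 0 < f j (x(i := u))"
      proof
        fix j assume "j \<in> {..<b}"
        then have j: "j < b" by simp
        have "((\<lambda>u. f j (x(i := u))) \<longlongrightarrow> f j x) (at (x i))"
          using polyf_isCont_coordinate[OF f[OF j], of x i] unfolding isCont_def by simp
        then show "\<forall>\<^sub>F u in at (x i). 0 < f j (x(i := u))"
          using fx[OF j] by (rule order_tendstoD)
      qed
      then have "\<forall>\<^sub>F u in at (x i). \<forall>j\<in>{..<b}. 0 < f j (x(i := u))"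
        by (intro eventually_ball_finite) auto
      then obtain r where r: "r > 0" "\<And>u. u \<noteq> x i \<Longrightarrow> dist u (x i) < r \<Longrightarrow> \<forall>j\<in>{..<b}. 0 < f j (x(i := u))"
        unfolding eventually_at by auto
      have "F (x(i := u)) \<le> F (x(i := x i))" if "\<bar>x i - u\<bar> < r" for u
      proof (cases "u = x i")
        case False
        then have "\<forall>j<b. 0 < f j (x(i := u))"
          using r(2)[of u] that by (auto simp: dist_real_def abs_minus_commute)
        moreover have "x(i := u) \<in> Rn n"
          using x(1) i \<open>k \<le> n\<close> unfolding M_iff by (simp add: Rn_eq)
        moreover have "\<forall>i'\<ge>k. (x(i := u)) i' = w i'"
          using x(1) i unfolding M_iff by simp
        ultimately have "x(i := u) \<in> M"
          unfolding M_iff by (simp add: less_imp_le)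
        then show ?thesis
          using x(2) by simp
      qed simp
      then show ?thesis
        using DERIV_local_max[OF F'[OF i] r(1)] by blast
    qed
    then show "\<exists>x\<in>Rn n. (\<forall>j<b. 0 < f j x) \<and> \<tau> \<le> (\<Prod>j<b. f j x) \<and> H x = 0 \<and> (\<forall>i\<ge>k. x i = w i)"
      using x(1) fx Gx unfolding M_iff H_iff G_def by blast
  next
    fix y :: "nat \<Rightarrow> real"
    show "finite {x. H x = 0 \<and> (\<forall>i\<ge>k. x i = y i)}"
    \<comment> \<open>\<open>F' i x = 0\<close> is solved for the power
      \<open>x i ^ (e - 1)\<close>; the right side has degree at most \<open>b * d - 1\<close>,
      which is below \<open>e - 1\<close>.\<close>
    proof (rule finite_solutions[where q="\<lambda>i x. inverse (t * real e) * G' i x" and n=n and e="e - 1" and y=y])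
      show "polyf n (e - 1 - 1) (\<lambda>x. inverse (t * real e) * G' i x)" for i
        using \<open>e > b * d\<close> by (intro polyf_cmult polyf_mono[OF G'(1)]) auto
      show "x i ^ (e - 1) = inverse (t * real e) * G' i x"
        if "i < k" "x \<in> {x. H x = 0 \<and> (\<forall>i\<ge>k. x i = y i)}" for i x
      proof -
        have "F' i x = 0"
          using that H_iff by blast
        then have "G' i x = (t * real e) * x i ^ (e - 1)"
          unfolding F'_def by simp
        then show ?thesis
          using \<open>t > 0\<close> \<open>e \<ge> 2\<close> by (simp add: field_simps)
      qed
    qed (use \<open>k \<le> n\<close> \<open>e \<ge> 2\<close> in auto)
  qed
qed

section \<open>Approximation of one basic set\<close>

text \<open>Only one half of the Hausdorff estimate for the projections is recorded; the other
  follows from the closeness of \<open>A\<close> to \<open>C\<close>. The last clause fixes the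
  shape from which the diagram is read off.\<close>

definition approx_piece :: "nat \<Rightarrow> nat \<Rightarrow> nat \<Rightarrow> nat \<Rightarrow> real \<Rightarrow> (nat \<Rightarrow> real) set \<Rightarrow> (nat \<Rightarrow> real) set \<Rightarrow> bool" where
  "approx_piece n l b D \<epsilon> C A \<longleftrightarrow> closed A \<and>
    (\<forall>x\<in>A. \<exists>z\<in>C. eucl_dist n x z \<le> \<epsilon>) \<and>
    (\<forall>z\<in>C. \<exists>x\<in>A. eucl_dist l (proj_last n l z) (proj_last n l x) \<le> \<epsilon>) \<and>
    (\<forall>y. finite {x \<in> A. \<forall>i<l. proj_last n l x i = y i}) \<and>
    (\<exists>f G H. (\<forall>j<b. polyf n D (f j)) \<and> polyf n D G \<and> polyf n D H \<and>
      A = {x \<in> Rn n. (\<forall>j<b. 0 < f j x) \<and> 0 \<le> G x \<and> H x = 0})"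

text \<open>The constants are chosen in the order \<open>N\<close>, \<open>\<delta>\<close>,
  \<open>\<eta>\<close>, \<open>\<gamma>\<close>, \<open>t\<close>. The factors have degree at most
  \<open>2 * d\<close>, their product at most \<open>2 * (b + 1) * d\<close>, and \<open>H\<close>
  at most \<open>4 * (b + 1) * d + 2\<close>, which is below \<open>4 * (b + 2) * d\<close> because
  \<open>1 \<le> d\<close>.\<close>

lemma exists_approx_piece:
  assumes p: "\<And>j. j < b \<Longrightarrow> polyf n d (p j)" and \<sigma>: "\<And>j. j < b \<Longrightarrow> \<sigma> j \<in> {0, 1, -1}"
    and "1 \<le> d" "l \<le> n" "\<epsilon> > 0"
    and R: "\<And>x. x \<in> sign_set n b p \<sigma> \<Longrightarrow> (\<Sum>i<n. (x i)\<^sup>2) < R"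
  shows "\<exists>A. approx_piece n l (Suc b) (4 * (b + 2) * d) \<epsilon> (sign_set n b p \<sigma>) A"
proof -
  define C where "C = sign_set n b p \<sigma>"
  have "C \<subseteq> {x \<in> Rn n. (\<Sum>i<n. (x i)\<^sup>2) \<le> R}"
    using R by (auto simp: C_def sign_set_def less_imp_le)
  from finite_net[OF this compact_Rn_ball \<open>\<epsilon> > 0\<close>, of n] obtain N where
    N: "finite N" "N \<subseteq> C" "\<And>z. z \<in> C \<Longrightarrow> \<exists>w\<in>N. eucl_dist n z w \<le> \<epsilon>"
    by blast
  have p_pos: "0 < \<sigma> j * p j w" if "w \<in> N" "j < b" "\<sigma> j \<noteq> 0" for w j
  proof -
    have "sgn (p j w) = \<sigma> j"
      using that N(2) by (auto simp: C_def sign_set_def)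
    then show ?thesis
      using that(3) by (metis abs_sgn mult.commute sgn_zero zero_less_abs_iff)
  qed
  define P where "P = (\<lambda>(w, j). \<sigma> j * p j w) ` (N \<times> {j. j < b \<and> \<sigma> j \<noteq> 0})"
  have "finite P"
    using N(1) by (simp add: P_def)
  moreover have "\<And>u. u \<in> P \<Longrightarrow> 0 < u"
    using p_pos by (auto simp: P_def)
  ultimately obtain \<delta> where \<delta>: "\<delta> > 0" "\<forall>u\<in>P. \<delta> < u"
    using finite_positive_lower_bound by blast
  from relaxed_sign_set_near[of b n d p \<sigma>, OF p \<sigma> \<open>\<epsilon> > 0\<close> \<delta>(1), of R, folded C_def]
  obtain \<eta> where \<eta>: "\<eta> > 0" "\<And>x. \<lbrakk>x \<in> Rn n; (\<Sum>i<n. (x i)\<^sup>2) \<le> R;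
      \<forall>j<b. if \<sigma> j = 0 then (p j x)\<^sup>2 \<le> \<eta> else \<delta> \<le> \<sigma> j * p j x\<rbrakk> \<Longrightarrow> \<exists>z\<in>C. eucl_dist n x z \<le> \<epsilon>"
    by blast
  \<comment> \<open>Index \<open>b\<close> is the ball, which makes the fibres compact.\<close>
  define f where "f j x = (if j = b then R - (\<Sum>i<n. (x i)\<^sup>2) else if \<sigma> j = 0 then \<eta> - (p j x)\<^sup>2
      else \<sigma> j * p j x - \<delta>)" for j x
  have f: "polyf n (2 * d) (f j)" if "j < Suc b" for j
  proof -
    have "polyf n (2 * d) (\<lambda>x. R - (\<Sum>i<n. (x i)\<^sup>2))"
      using \<open>1 \<le> d\<close> by (intro polyf_diff polyf_const polyf_sum polyf_mono[OF polyf_power[OF polyf_var[of _ n 1]]]) auto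
    moreover have "polyf n (2 * d) (\<lambda>x. \<eta> - (p j x)\<^sup>2)" "polyf n (2 * d) (\<lambda>x. \<sigma> j * p j x - \<delta>)" if "j < b"
      by (intro polyf_diff polyf_const polyf_power p that polyf_cmult polyf_mono[OF p[OF that]], simp)+
    ultimately show ?thesis
      using that unfolding f_def by (cases "j = b"; cases "\<sigma> j = 0") (simp_all add: less_Suc_eq)
  qed
  have fN: "0 < f j w" if "w \<in> N" "j < Suc b" for w j
  proof -
    have "w \<in> C"
      using that N(2) by blast
    moreover have "p j w = 0" if "j < b" "\<sigma> j = 0"
      using \<open>w \<in> C\<close> that by (auto simp: C_def sign_set_def sgn_zero_iff)
    moreover have "\<delta> < \<sigma> j * p j w" if "j < b" "\<sigma> j \<noteq> 0"
      using \<delta>(2) \<open>w \<in> N\<close> that by (force simp: P_def)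
    ultimately show ?thesis
      using that(2) R \<eta>(1) unfolding f_def C_def by (auto simp: less_Suc_eq)
  qed
  define G where "G x = (\<Prod>j<Suc b. f j x)" for x
  have "finite (G ` N)"
    using N(1) by simp
  moreover have "\<And>u. u \<in> G ` N \<Longrightarrow> 0 < u"
    using fN unfolding G_def by (auto intro!: prod_pos simp del: prod.lessThan_Suc)
  ultimately obtain \<gamma> where \<gamma>: "\<gamma> > 0" "\<And>w. w \<in> N \<Longrightarrow> \<gamma> < G w"
    using finite_positive_lower_bound[of "G ` N"] by blast
  \<comment> \<open>The least even number above the degree bound of \<open>G\<close>.\<close>
  define e where "e = Suc b * (2 * d) + 2"
  define s where "s w = (\<Sum>i<n - l. w i ^ e)" for w :: "nat \<Rightarrow> real"
  have "even e"
    by (simp add: e_def)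
  have s_nonneg: "0 \<le> s w" for w
    using \<open>even e\<close> by (simp add: s_def sum_nonneg zero_le_even_power)
  define T where "T = (\<Sum>w\<in>N. s w)"
  have sT: "s w \<le> T" if "w \<in> N" for w
    unfolding T_def using that N(1) s_nonneg by (intro member_le_sum) auto
  have "0 \<le> T"
    unfolding T_def using s_nonneg by (intro sum_nonneg)
  \<comment> \<open>\<open>T\<close> bounds the power sums on the net, so the penalty there is at
    most \<open>\<gamma> / 2\<close> and leaves the level \<open>\<gamma> / 2\<close>; the summand 1
    avoids division by 0.\<close>
  define t where "t = \<gamma> / 2 / (T + 1)"
  have "t > 0"
    using \<gamma>(1) \<open>0 \<le> T\<close> by (simp add: t_def)
  have "t * s w \<le> \<gamma> / 2" if "w \<in> N" for w
  proof -
    have "t * s w \<le> t * (T + 1)"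
      using sT[OF that] \<open>t > 0\<close> by (intro mult_left_mono) auto
    also have "\<dots> = \<gamma> / 2"
      using \<open>0 \<le> T\<close> t_def nonzero_divide_eq_eq[of "T + 1" "\<gamma> / 2" t] by simp
    finally show ?thesis .
  qed
  then have level: "\<gamma> / 2 + t * (\<Sum>i<n - l. w i ^ e) \<le> (\<Prod>j<Suc b. f j w)" if "w \<in> N" for w
    using \<gamma>(2)[OF that] that unfolding s_def G_def by fastforce
  have e: "e > Suc b * (2 * d)" "Suc b * (2 * d) \<ge> 1" "\<gamma> / 2 > 0" "n - l \<le> n"
    using \<open>1 \<le> d\<close> \<gamma>(1) by (auto simp: e_def)
  have "(\<Sum>i<n. (x i)\<^sup>2) \<le> R" if "\<And>j. j < Suc b \<Longrightarrow> 0 \<le> f j x" for x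
    using that[of b] by (simp add: f_def)
  from critical_points[of "Suc b" n "2 * d" f, OF f e(4) \<open>even e\<close> e(1,2) \<open>t > 0\<close> e(3) this]
  obtain H where H: "polyf n (2 * (e - 1)) H"
    "\<And>w. \<lbrakk>w \<in> Rn n; \<forall>j<Suc b. 0 \<le> f j w; \<gamma> / 2 + t * (\<Sum>i<n - l. w i ^ e) \<le> (\<Prod>j<Suc b. f j w)\<rbrakk> \<Longrightarrow>
      \<exists>x\<in>Rn n. (\<forall>j<Suc b. 0 < f j x) \<and> \<gamma> / 2 \<le> (\<Prod>j<Suc b. f j x) \<and> H x = 0 \<and> (\<forall>i\<ge>n - l. x i = w i)"
    "\<And>y. finite {x. H x = 0 \<and> (\<forall>i\<ge>n - l. x i = y i)}"
    by blast
  define A where "A = {x \<in> Rn n. (\<forall>j<Suc b. 0 < f j x) \<and> 0 \<le> G x - \<gamma> / 2 \<and> H x = 0}"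
  have deg: "2 * d \<le> 4 * (b + 2) * d" "Suc b * (2 * d) \<le> 4 * (b + 2) * d" "2 * (e - 1) \<le> 4 * (b + 2) * d"
    using \<open>1 \<le> d\<close> by (auto simp: e_def algebra_simps)
  have G: "polyf n (Suc b * (2 * d)) G"
    using polyf_prod[of "{..<Suc b}" n "\<lambda>_. 2 * d" f] f unfolding G_def by simp
  \<comment> \<open>Weak inequalities define the same set, since no factor vanishes where the
    product is at least \<open>\<gamma> / 2\<close>. This is why strict conditions give a closed
    set.\<close>
  have A_closed_eq: "A = Rn n \<inter> ((\<Inter>j\<in>{..<Suc b}. {x. 0 \<le> f j x}) \<inter> ({x. \<gamma> / 2 \<le> G x} \<inter> {x. H x = 0}))"
  proof -
    have "0 < f j x" if "\<forall>j<Suc b. 0 \<le> f j x" "\<gamma> / 2 \<le> G x" "j < Suc b" for j x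
    proof (rule ccontr)
      assume "\<not> 0 < f j x"
      then have "f j x = 0"
        using that by force
      then have "G x = 0"
        unfolding G_def using that(3) by (intro prod_zero) auto
      then show False
        using that(2) \<gamma>(1) by simp
    qed
    then show ?thesis
      unfolding A_def by (auto simp del: less_Suc_eq intro: less_imp_le)
  qed
  have "closed A"
  proof -
    have "closed {x. 0 \<le> f j x}" if "j < Suc b" for j
      by (intro closed_Collect_le continuous_on_const continuous_on_polyf[OF f[OF that]])
    moreover have "closed {x. \<gamma> / 2 \<le> G x}"
      by (intro closed_Collect_le continuous_on_const continuous_on_polyf[OF G])
    moreover have "closed {x. H x = 0}"
      by (intro closed_Collect_eq continuous_on_const continuous_on_polyf[OF H(1)])
    ultimately show ?thesis
      unfolding A_closed_eq by (intro closed_Int closed_Rn closed_INT) auto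
  qed
  moreover have "\<exists>z\<in>C. eucl_dist n x z \<le> \<epsilon>" if "x \<in> A" for x
  proof (rule \<eta>(2))
    have pos: "0 < f j x" if "j < Suc b" for j
      using \<open>x \<in> A\<close> that by (simp add: A_def)
    show "(\<Sum>i<n. (x i)\<^sup>2) \<le> R"
      using pos[of b] by (simp add: f_def)
    show "\<forall>j<b. if \<sigma> j = 0 then (p j x)\<^sup>2 \<le> \<eta> else \<delta> \<le> \<sigma> j * p j x"
    proof (intro allI impI)
      fix j assume "j < b"
      then show "if \<sigma> j = 0 then (p j x)\<^sup>2 \<le> \<eta> else \<delta> \<le> \<sigma> j * p j x"
        using pos[of j] by (simp add: f_def split: if_splits)
    qed
  qed (use that in \<open>simp add: A_def\<close>)
  moreover have "\<exists>x\<in>A. eucl_dist l (proj_last n l z) (proj_last n l x) \<le> \<epsilon>" if z: "z \<in> C" for z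
  proof -
    obtain w where w: "w \<in> N" "eucl_dist n z w \<le> \<epsilon>"
      using N(3)[OF z] by blast
    have "w \<in> Rn n"
      using w(1) N(2) by (auto simp: C_def sign_set_def)
    then obtain x where x: "x \<in> Rn n" "\<forall>j<Suc b. 0 < f j x" "\<gamma> / 2 \<le> G x" "H x = 0" "\<forall>i\<ge>n - l. x i = w i"
      using H(2)[of w] fN[OF w(1)] level[OF w(1)] unfolding G_def by (meson less_imp_le)
    have "proj_last n l x = proj_last n l w"
      using x(5) by (auto simp: proj_last_def)
    then have "eucl_dist l (proj_last n l z) (proj_last n l x) \<le> \<epsilon>"
      using eucl_dist_proj_last_le[OF \<open>l \<le> n\<close>, of z w] w(2) by simp
    moreover have "x \<in> A"
      using x by (simp add: A_def)
    ultimately show ?thesis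
      by blast
  qed
  moreover have "finite {x \<in> A. \<forall>i<l. proj_last n l x i = y i}" for y
  proof (rule finite_subset[OF _ H(3)])
    \<comment> \<open>The projection fixes the coordinates from \<open>n - l\<close> to
      \<open>n - 1\<close>; from index \<open>n\<close> on, points of \<open>A\<close>
      vanish.\<close>
    show "{x \<in> A. \<forall>i<l. proj_last n l x i = y i} \<subseteq>
        {x. H x = 0 \<and> (\<forall>i\<ge>n - l. x i = (if i < n then y (i - (n - l)) else 0))}"
    proof safe
      fix x i assume x: "x \<in> A" "\<forall>i<l. proj_last n l x i = y i" and i: "n - l \<le> i"
      show "x i = (if i < n then y (i - (n - l)) else 0)"
      proof (cases "i < n")
        case True
        then have "i - (n - l) < l"
          using i by linarith
        with x(2) have "proj_last n l x (i - (n - l)) = y (i - (n - l))"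
          by blast
        then show ?thesis
          using \<open>i - (n - l) < l\<close> True i by (simp add: proj_last_def)
      next
        case False
        then show ?thesis
          using x(1) by (simp add: A_def Rn_eq)
      qed
    qed (simp add: A_def)
  qed
  moreover have "\<forall>j<Suc b. polyf n (4 * (b + 2) * d) (f j)" "polyf n (4 * (b + 2) * d) H"
    "polyf n (4 * (b + 2) * d) (\<lambda>x. G x - \<gamma> / 2)"
    using polyf_mono[OF f deg(1)] polyf_mono[OF H(1) deg(3)] polyf_diff[OF polyf_mono[OF G deg(2)] polyf_const]
    by blast+
  ultimately show ?thesis
    unfolding approx_piece_def C_def[symmetric] using A_def by blast
qed

section \<open>Unions of basic sets\<close>

lemma polyf_0_const: "polyf n d f \<Longrightarrow> d = 0 \<Longrightarrow> f x = f y"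
  by (induction rule: polyf.induct) auto

definition basic_set :: "nat \<Rightarrow> nat \<Rightarrow> nat \<Rightarrow> (nat \<Rightarrow> real) set \<Rightarrow> bool" where
  "basic_set n m D B \<longleftrightarrow> (\<exists>b p \<sigma>. b \<le> m \<and>
    (\<forall>j<b. poly_in_vars n (p j) \<and> poly_degree (p j) \<le> D \<and> \<sigma> j \<in> {0, 1, -1}) \<and>
    B = sign_set n b (\<lambda>j. poly_eval (p j)) \<sigma>)"

lemma basic_set_sign_set:
  assumes "b \<le> m" "\<And>j. j < b \<Longrightarrow> polyf n D (f j)" "\<And>j. j < b \<Longrightarrow> \<sigma> j \<in> {0, 1, -1}"
  shows "basic_set n m D (sign_set n b f \<sigma>)"
proof -
  have "\<exists>p. j < b \<longrightarrow> poly_in_vars n p \<and> poly_degree p \<le> D \<and> (\<forall>x. poly_eval p x = f j x)" for j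
    using polyf_imp_rpoly_fun[OF assms(2)] unfolding rpoly_fun_def by blast
  then obtain p where p: "\<And>j. j < b \<longrightarrow> poly_in_vars n (p j) \<and> poly_degree (p j) \<le> D \<and> (\<forall>x. poly_eval (p j) x = f j x)"
    by metis
  moreover have "sign_set n b f \<sigma> = sign_set n b (\<lambda>j. poly_eval (p j)) \<sigma>"
    unfolding sign_set_def using p by auto
  ultimately show ?thesis
    unfolding basic_set_def using assms(1,3) by (intro exI[of _ b] exI[of _ p] exI[of _ \<sigma>]) auto
qed

lemma basic_set_mono:
  assumes "basic_set n m D B" "m \<le> m'" "D \<le> D'"
  shows "basic_set n m' D' B"
proof -
  obtain b p \<sigma> where "b \<le> m" "\<forall>j<b. poly_in_vars n (p j) \<and> poly_degree (p j) \<le> D \<and> \<sigma> j \<in> {0, 1, -1}"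
    "B = sign_set n b (\<lambda>j. poly_eval (p j)) \<sigma>"
    using assms(1) unfolding basic_set_def by blast
  then show ?thesis
    unfolding basic_set_def using assms(2,3)
    by (intro exI[of _ b] exI[of _ p] exI[of _ \<sigma>]) (auto intro: le_trans)
qed

lemma diagram_Union_basic:
  assumes "\<And>i. i < N \<Longrightarrow> basic_set n m D (B i)" "N * m \<le> c"
  shows "diagram n (\<Union>i<N. B i) n c D"
proof -
  define rep where "rep i w \<longleftrightarrow> (case w of (b, p, \<sigma>) \<Rightarrow> b \<le> m \<and>
    (\<forall>j<b. poly_in_vars n (p j) \<and> poly_degree (p j) \<le> D \<and> \<sigma> j \<in> {0, 1, -1}) \<and>
    B i = sign_set n b (\<lambda>j. poly_eval (p j)) \<sigma>)" for i w
  have "\<exists>w. rep i w" if i: "i < N" for i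
  proof -
    obtain b p \<sigma> where "rep i (b, p, \<sigma>)"
      using assms(1)[OF i] unfolding basic_set_def rep_def prod.case by blast
    then show ?thesis
      by blast
  qed
  then obtain h where h: "\<And>i. i < N \<Longrightarrow> rep i (h i)"
    by metis
  define b where "b i = fst (h i)" for i
  define p where "p i = fst (snd (h i))" for i
  define \<sigma> where "\<sigma> i = snd (snd (h i))" for i
  have b: "b i \<le> m" and p: "\<forall>j<b i. poly_in_vars n (p i j) \<and> poly_degree (p i j) \<le> D \<and> \<sigma> i j \<in> {0, 1, -1}"
    and B: "B i = sign_set n (b i) (\<lambda>j. poly_eval (p i j)) (\<sigma> i)" if "i < N" for i
    using h[OF that] unfolding b_def p_def \<sigma>_def rep_def case_prod_beta by blast+
  have "sa_representation n (\<Union>i<N. B i) N b p \<sigma>"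
    unfolding sa_representation_def
  proof
    show "\<forall>i<N. \<forall>j<b i. poly_in_vars n (p i j) \<and> \<sigma> i j \<in> {0, 1, - 1}"
      using p by blast
    show "(\<Union>i<N. B i) = (\<Union>i<N. Rn n \<inter> (\<Inter>j<b i. {x \<in> Rn n. sgn (poly_eval (p i j) x) = \<sigma> i j}))"
      by (rule SUP_cong) (auto simp: B sign_set_def)
  qed
  moreover have "Max (insert 0 (b ` {..<N})) \<le> m"
    using b by auto
  then have "N * Max (insert 0 (b ` {..<N})) \<le> c"
    using assms(2) le_trans mult_le_mono2 by blast
  ultimately show ?thesis
    unfolding diagram_def using p by blast
qed

lemma diagram_imp_semialgebraic: "diagram n A m c d \<Longrightarrow> semialgebraic n A"
  unfolding diagram_def semialgebraic_def by blast

text \<open>A weak inequality is not a sign condition: \<open>0 \<le> G x\<close> splits into sign 0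
  and sign 1, which doubles the number of basic sets.\<close>

lemma approx_piece_eq_basic_Un:
  assumes "approx_piece n l b D \<epsilon> C A"
  obtains B1 B2 where "A = B1 \<union> B2" "basic_set n (b + 2) D B1" "basic_set n (b + 2) D B2"
proof -
  obtain f G H where f: "\<And>j. j < b \<Longrightarrow> polyf n D (f j)" and G: "polyf n D G" and H: "polyf n D H"
    and A: "A = {x \<in> Rn n. (\<forall>j<b. 0 < f j x) \<and> 0 \<le> G x \<and> H x = 0}"
    using assms unfolding approx_piece_def by blast
  define g where "g j = (if j < b then f j else if j = b then G else H)" for j
  define \<sigma> where "\<sigma> s j = (if j < b then 1 else if j = b then s else 0)" for s :: real and j
  have "basic_set n (b + 2) D (sign_set n (b + 2) g (\<sigma> s))" if "s \<in> {0, 1}" for s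
    using f G H that by (intro basic_set_sign_set) (auto simp: g_def \<sigma>_def)
  moreover have "sign_set n (b + 2) g (\<sigma> s) = {x \<in> Rn n. (\<forall>j<b. 0 < f j x) \<and> sgn (G x) = s \<and> H x = 0}" for s
    unfolding sign_set_def g_def \<sigma>_def by (auto simp: less_Suc_eq all_conj_distrib sgn_1_pos sgn_0_0)
  then have "A = sign_set n (b + 2) g (\<sigma> 0) \<union> sign_set n (b + 2) g (\<sigma> 1)"
    unfolding A by (auto simp: sgn_1_pos sgn_0_0)
  ultimately show ?thesis
    using that by blast
qed

section \<open>Boundedness and assembly of the pieces\<close>

lemma Rn_eucl_dist_zero: "(\<Sum>i<n. (x i)\<^sup>2) = (eucl_dist n x (\<lambda>_. 0))\<^sup>2"
  by (simp add: eucl_dist_def L2_set_def sum_nonneg)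

lemma bounded_in_imp_sum_squares_less:
  assumes "bounded_in n S"
  shows "\<exists>R. \<forall>x\<in>S. (\<Sum>i<n. (x i)\<^sup>2) < R"
proof -
  interpret Metric_space "Rn n" "eucl_dist n"
    by (rule Metric_space_eucl_dist)
  obtain a r where S: "S \<subseteq> mcball a r"
    using assms unfolding bounded_in_def mbounded_def by blast
  have "(\<Sum>i<n. (x i)\<^sup>2) < (r + eucl_dist n a (\<lambda>_. 0))\<^sup>2 + 1" if "x \<in> S" for x
  proof -
    have x: "x \<in> Rn n" "a \<in> Rn n" "eucl_dist n a x \<le> r"
      using S that by (auto simp: mcball_def)
    have "(\<lambda>_. 0) \<in> Rn n"
      by (simp add: Rn_eq)
    then have "eucl_dist n x (\<lambda>_. 0) \<le> eucl_dist n x a + eucl_dist n a (\<lambda>_. 0)"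
      using x by (intro triangle)
    then have "eucl_dist n x (\<lambda>_. 0) \<le> r + eucl_dist n a (\<lambda>_. 0)"
      using x(3) commute[of x a] by linarith
    then have "(eucl_dist n x (\<lambda>_. 0))\<^sup>2 \<le> (r + eucl_dist n a (\<lambda>_. 0))\<^sup>2"
      by (intro power_mono) (simp_all add: eucl_dist_def L2_set_nonneg)
    then show ?thesis
      unfolding Rn_eucl_dist_zero by linarith
  qed
  then show ?thesis
    by blast
qed

lemma Rn_not_bounded:
  assumes "1 \<le> n" "\<And>x. x \<in> Rn n \<Longrightarrow> (\<Sum>i<n. (x i)\<^sup>2) < R"
  shows False
proof -
  define x :: "nat \<Rightarrow> real" where "x = (\<lambda>i. if i = 0 then \<bar>R\<bar> + 1 else 0)"
  have "x \<in> Rn n"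
    using \<open>1 \<le> n\<close> by (auto simp: x_def Rn_eq)
  then have "(\<Sum>i<n. (x i)\<^sup>2) < R"
    by (rule assms(2))
  moreover have "(x 0)\<^sup>2 \<le> (\<Sum>i<n. (x i)\<^sup>2)"
    using \<open>1 \<le> n\<close> by (intro member_le_sum) auto
  moreover have "\<bar>R\<bar> + 1 \<le> (\<bar>R\<bar> + 1)\<^sup>2"
    by (rule self_le_power) auto
  ultimately show False
    by (simp add: x_def)
qed

lemma dist_to_set_le: "z \<in> S \<Longrightarrow> eucl_dist n x z \<le> \<epsilon> \<Longrightarrow> dist_to_set n x S \<le> ennreal \<epsilon>"
  unfolding dist_to_set_def by (rule INF_lower2) (auto intro: ennreal_leI)

text \<open>\<open>\<kappa>\<close> adds a bound for the conditions and one for the degrees. There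
  are at most \<open>c\<close> pieces, each the union of two basic sets with at most
  \<open>c + 3\<close> conditions (\<open>c\<close> relaxed ones, the ball, \<open>G\<close> and
  \<open>H\<close>), of degree at most \<open>4 * (c + 2) * d\<close>.\<close>

theorem bounded_diagram_approximation:
  assumes "1 \<le> l" "l \<le> n" "bounded_in n S" "diagram n S n c d" "\<epsilon> > 0"
    and \<kappa>: "\<kappa> = 2 * c * (c + 3) + 4 * (c + 2)"
  shows "\<exists>A. closedin (Euclidean_space n) A \<and> semialgebraic n A \<and> sa_dim n A \<le> ereal (real l) \<and>
    A \<subseteq> nbhd n \<epsilon> S \<and> hausdorff_dist l (proj_last n l ` A) (proj_last n l ` S) \<le> ennreal \<epsilon> \<and>
    diagram n A n \<kappa> (\<kappa> * d)"
proof -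
  have "1 \<le> n"
    using assms(1,2) by linarith
  obtain R where R: "\<And>x. x \<in> S \<Longrightarrow> (\<Sum>i<n. (x i)\<^sup>2) < R"
    using bounded_in_imp_sum_squares_less[OF \<open>bounded_in n S\<close>] by blast
  obtain a b p \<sigma> where rep: "sa_representation n S a b p \<sigma>"
    and ab: "a * Max (insert 0 (b ` {..<a})) \<le> c" and deg: "\<And>i j. i < a \<Longrightarrow> j < b i \<Longrightarrow> poly_degree (p i j) \<le> d"
    using \<open>diagram n S n c d\<close> unfolding diagram_def by blast
  define C where "C i = sign_set n (b i) (\<lambda>j. poly_eval (p i j)) (\<sigma> i)" for i
  have S: "S = (\<Union>i<a. C i)"
  proof -
    have "S = (\<Union>i<a. Rn n \<inter> (\<Inter>j<b i. {x \<in> Rn n. sgn (poly_eval (p i j) x) = \<sigma> i j}))"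
      using rep unfolding sa_representation_def by blast
    also have "\<dots> = (\<Union>i<a. C i)"
      by (rule SUP_cong) (auto simp: C_def sign_set_def)
    finally show ?thesis .
  qed
  have pol: "polyf n d (poly_eval (p i j))" and sgn: "\<sigma> i j \<in> {0, 1, -1}" if "i < a" "j < b i" for i j
    using rep that deg[OF that] unfolding sa_representation_def by (blast intro: polyf_poly_eval)+
  have bmax: "b i \<le> Max (insert 0 (b ` {..<a}))" if "i < a" for i
    using that by (intro Max_ge) auto
  \<comment> \<open>The bound on the product of \<open>a\<close> and the largest \<open>b i\<close>
    controls \<open>a\<close> only if some condition occurs, and the pieces require
    \<open>1 \<le> d\<close>. Without conditions, or with constant polynomials only, a nonempty
    basic set would be the whole space, which is unbounded as \<open>1 \<le> n\<close>.\<close>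
  have nondegenerate: "1 \<le> d \<and> a \<le> c \<and> b i \<le> c" if "i < a" "S \<noteq> {}" for i
  proof -
    have "\<exists>i j. i < a \<and> j < b i \<and> 1 \<le> d"
    proof (rule ccontr)
      assume triv: "\<not> ?thesis"
      obtain i x where i: "i < a" "x \<in> C i"
        using \<open>S \<noteq> {}\<close> S by blast
      have "y \<in> S" if "y \<in> Rn n" for y
      proof -
        have "poly_eval (p i j) y = poly_eval (p i j) x" if "j < b i" for j
          using polyf_0_const[OF pol[OF i(1) that]] triv i(1) that by (metis less_one not_less)
        then have "y \<in> C i"
          using i(2) \<open>y \<in> Rn n\<close> unfolding C_def sign_set_def by auto
        then show ?thesis
          using S i(1) by blast
      qed
      then show False
        using Rn_not_bounded[OF \<open>1 \<le> n\<close>, of R] R by blast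
    qed
    then obtain i' j where ij: "i' < a" "j < b i'" "1 \<le> d"
      by blast
    define M where "M = Max (insert 0 (b ` {..<a}))"
    have "1 \<le> M" "1 \<le> a" "b i \<le> M" "a * M \<le> c"
      using bmax[OF ij(1)] bmax[OF that(1)] ij ab by (auto simp: M_def[symmetric])
    then have "a * 1 \<le> a * M" "1 * M \<le> a * M"
      by (intro mult_le_mono; simp)+
    then show ?thesis
      using ij(3) \<open>b i \<le> M\<close> \<open>a * M \<le> c\<close> by linarith
  qed
  define I where "I = (if S = {} then 0 else a)"
  have I: "i < a" "1 \<le> d" "a \<le> c" "b i \<le> c" if "i < I" for i
    using that nondegenerate[of i] by (auto simp: I_def split: if_splits)
  have S_I: "S = (\<Union>i<I. C i)"
    using S by (auto simp: I_def)
  have "\<exists>A. approx_piece n l (Suc (b i)) (4 * (b i + 2) * d) \<epsilon> (C i) A" if i: "i < I" for i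
  proof -
    have "(\<Sum>i<n. (x i)\<^sup>2) < R" if "x \<in> sign_set n (b i) (\<lambda>j. poly_eval (p i j)) (\<sigma> i)" for x
      using that R S I(1)[OF i] unfolding C_def by blast
    then show ?thesis
      unfolding C_def using I[OF i] assms by (intro exists_approx_piece[where R=R] pol sgn) auto
  qed
  then obtain Ap where Ap: "\<And>i. i < I \<Longrightarrow> approx_piece n l (Suc (b i)) (4 * (b i + 2) * d) \<epsilon> (C i) (Ap i)"
    by metis
  have "\<exists>B1 B2. Ap i = B1 \<union> B2 \<and> basic_set n (c + 3) (\<kappa> * d) B1 \<and> basic_set n (c + 3) (\<kappa> * d) B2"
    if i: "i < I" for i
  proof -
    have le: "Suc (b i) + 2 \<le> c + 3" "4 * (b i + 2) * d \<le> \<kappa> * d"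
      using I(4)[OF i] by (auto simp: \<kappa> intro!: mult_le_mono1)
    from approx_piece_eq_basic_Un[OF Ap[OF i]] obtain B1 B2 where
      "Ap i = B1 \<union> B2" "basic_set n (Suc (b i) + 2) (4 * (b i + 2) * d) B1"
      "basic_set n (Suc (b i) + 2) (4 * (b i + 2) * d) B2" .
    then show ?thesis
      by (intro exI[of _ B1] exI[of _ B2] conjI basic_set_mono[OF _ le]) assumption+
  qed
  then obtain B1 B2 where B: "\<And>i. i < I \<Longrightarrow> Ap i = B1 i \<union> B2 i"
    "\<And>i. i < I \<Longrightarrow> basic_set n (c + 3) (\<kappa> * d) (B1 i)" "\<And>i. i < I \<Longrightarrow> basic_set n (c + 3) (\<kappa> * d) (B2 i)"
    by metis
  define A where "A = (\<Union>i<I. Ap i)"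
  \<comment> \<open>The \<open>2 * I\<close> basic sets are listed as one family, as
    \<open>diagram_Union_basic\<close> requires.\<close>
  define E where "E i = (if i < I then B1 i else B2 (i - I))" for i
  have A_eq: "A = (\<Union>i<2 * I. E i)"
  proof -
    have "{..<2 * I} = {..<I} \<union> (\<lambda>i. i + I) ` {..<I}"
    proof (intro equalityI subsetI)
      fix i assume "i \<in> {..<2 * I}"
      then show "i \<in> {..<I} \<union> (\<lambda>i. i + I) ` {..<I}"
        by (cases "i < I") (auto intro!: image_eqI[of _ _ "i - I"])
    qed auto
    then have "(\<Union>i<2 * I. E i) = (\<Union>i<I. E i) \<union> (\<Union>i<I. E (i + I))"
      by auto
    also have "(\<Union>i<I. E i) = (\<Union>i<I. B1 i)"
      by (rule SUP_cong) (auto simp: E_def)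
    also have "(\<Union>i<I. E (i + I)) = (\<Union>i<I. B2 i)"
      by (rule SUP_cong) (auto simp: E_def)
    finally show ?thesis
      using B(1) by (auto simp: A_def)
  qed
  have "I \<le> c"
    using I(3)[of 0] by (cases "I = 0") (auto simp: I_def split: if_splits)
  then have "2 * I * (c + 3) \<le> 2 * c * (c + 3)"
    by (intro mult_le_mono) auto
  then have "2 * I * (c + 3) \<le> \<kappa>"
    unfolding \<kappa> by linarith
  then have diag: "diagram n A n \<kappa> (\<kappa> * d)"
    unfolding A_eq using B(2,3) by (intro diagram_Union_basic[where m="c + 3"]) (auto simp: E_def)
  have "closed A" "A \<subseteq> Rn n"
    using Ap unfolding A_def approx_piece_def by (auto intro!: closed_UN)
  then have "closedin (Euclidean_space n) A"
    by (simp add: closedin_Euclidean_space_iff)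
  moreover have "finite {x \<in> A. \<forall>i<l. proj_last n l x i = y i}" for y
  proof -
    have "{x \<in> A. \<forall>i<l. proj_last n l x i = y i} = (\<Union>j<I. {x \<in> Ap j. \<forall>i<l. proj_last n l x i = y i})"
      by (auto simp: A_def)
    then show ?thesis
      using Ap unfolding approx_piece_def by simp
  qed
  then have "sa_dim n A \<le> ereal (real l)"
    by (rule sa_dim_le_of_finite_fibres)
  moreover have near: "\<exists>z\<in>S. eucl_dist n x z \<le> \<epsilon>" if "x \<in> A" for x
  proof -
    obtain i where i: "i < I" "x \<in> Ap i"
      using \<open>x \<in> A\<close> unfolding A_def by blast
    then obtain z where "z \<in> C i" "eucl_dist n x z \<le> \<epsilon>"
      using Ap[OF i(1)] unfolding approx_piece_def by blast
    then show ?thesis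
      using i(1) unfolding S_I by blast
  qed
  then have "A \<subseteq> nbhd n \<epsilon> S"
    using \<open>A \<subseteq> Rn n\<close> unfolding nbhd_def by (auto dest: near intro: dist_to_set_le)
  moreover have "hausdorff_dist l (proj_last n l ` A) (proj_last n l ` S) \<le> ennreal \<epsilon>"
    unfolding hausdorff_dist_def
  proof (intro max.boundedI SUP_least)
    fix u assume "u \<in> proj_last n l ` A"
    then obtain x where x: "x \<in> A" "u = proj_last n l x"
      by blast
    then obtain z where "z \<in> S" "eucl_dist n x z \<le> \<epsilon>"
      using near by blast
    then show "dist_to_set l u (proj_last n l ` S) \<le> ennreal \<epsilon>"
      using eucl_dist_proj_last_le[OF \<open>l \<le> n\<close>, of x z] x(2) by (intro dist_to_set_le[of "proj_last n l z"]) auto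
  next
    fix v assume "v \<in> proj_last n l ` S"
    then obtain z i where z: "z \<in> C i" "i < I" "v = proj_last n l z"
      unfolding S_I by blast
    then obtain x where "x \<in> Ap i" "eucl_dist l (proj_last n l z) (proj_last n l x) \<le> \<epsilon>"
      using Ap[OF z(2)] unfolding approx_piece_def by blast
    then show "dist_to_set l v (proj_last n l ` A) \<le> ennreal \<epsilon>"
      using z by (intro dist_to_set_le[of "proj_last n l x"]) (auto simp: A_def)
  qed
  ultimately show ?thesis
    using diag diagram_imp_semialgebraic[OF diag] by blast
qed

theorem theorem1:
  "\<forall>c::nat. \<exists>\<kappa>::nat. \<forall>(n::nat) (l::nat) (d::nat) (S::(nat \<Rightarrow> real) set).
     1 \<le> l \<and> l \<le> n \<and>
     bounded_in n S \<and> closedin (Euclidean_space n) S \<and> semialgebraic n S \<and>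
     diagram n S n c d \<longrightarrow>
     (\<forall>\<epsilon>::real. \<epsilon> > 0 \<longrightarrow>
       (\<exists>A::(nat \<Rightarrow> real) set.
          closedin (Euclidean_space n) A \<and> semialgebraic n A \<and>
          sa_dim n A \<le> ereal (real l) \<and>
          A \<subseteq> nbhd n \<epsilon> S \<and>
          hausdorff_dist l (proj_last n l ` A) (proj_last n l ` S) \<le> ennreal \<epsilon> \<and>
          diagram n A n \<kappa> (\<kappa> * d)))"
proof (rule allI)
  fix c :: nat
  define \<kappa> where "\<kappa> = 2 * c * (c + 3) + 4 * (c + 2)"
  show "\<exists>\<kappa>::nat. \<forall>(n::nat) (l::nat) (d::nat) (S::(nat \<Rightarrow> real) set).
     1 \<le> l \<and> l \<le> n \<and>
     bounded_in n S \<and> closedin (Euclidean_space n) S \<and> semialgebraic n S \<and>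
     diagram n S n c d \<longrightarrow>
     (\<forall>\<epsilon>::real. \<epsilon> > 0 \<longrightarrow>
       (\<exists>A::(nat \<Rightarrow> real) set.
          closedin (Euclidean_space n) A \<and> semialgebraic n A \<and>
          sa_dim n A \<le> ereal (real l) \<and>
          A \<subseteq> nbhd n \<epsilon> S \<and>
          hausdorff_dist l (proj_last n l ` A) (proj_last n l ` S) \<le> ennreal \<epsilon> \<and>
          diagram n A n \<kappa> (\<kappa> * d)))"
    using bounded_diagram_approximation[of _ _ _ c] unfolding \<kappa>_def by blast
qed

end
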